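(* Let $F$ be a symmetric plane forest of size $n$ with $k$ center vertices, let $F^{-}$ be its left part, and let $\lambda$ be the Dyck path corresponding to $F$. Then $$|\mathcal{D}_{\mathrm{sym}}(\lambda/* )| = 2^{n-k} \frac{n!}{\prod_{x\in F^{-}} h_x}.$$ If $k=0$, then $$\sum_{D\in\mathcal{D}_{\mathrm{sym}}(\lambda/* )} q^{\mathrm{art}_+(D) + \mathrm{art}_0(D)}t^{\mathrm{tiles}_0(D)} = (1+tq)(1+tq^2)\cdots(1+tq^n) \frac{[n]_q!}{\prod_{x\in F^{-}} [h_x]_q}.$$
   Context: Symmetric forests. A symmetric plane forest is a plane forest invariant under the reflection about a (vertical) line, the center line. A center vertex is a vertex on the center line. The left part $F^{-}$ of a symmetric plane forest $F$ is the subforest consisting of the vertices on or to the left of the center line; the size of $F$ is the number of vertices of $F^{-}$. For a vertex $x$ of $F^{-}$, the hook length $h_x$ is the number of vertices of $F^{-}$ that are descendants of $x$, including $x$ itself. Also $[m]_q=1+q+\cdots+q^{m-1}$ and $[m]_q!=[1]_q\cdots[m]_q$. Dyck paths and forests. A Dyck path of length $2N$ is a lattice path of up steps $(0,1)$ and down steps $(1,0)$ from $(0,0)$ to $(N,N)$ never going strictly below $y=x$. A plane forest with $N$ vertices corresponds to a Dyck path of length $2N$: each pair consisting of an up step and its matching down step corresponds to a vertex, descendants correspond to nested pairs, and the left-to-right order is the order along the path. A Dyck path of length $2N$ is symmetric if it is invariant under reflection along the line $x+y=N$; symmetric plane forests correspond to symmetric Dyck paths. Symmetric Dyck tilings. Cells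 are unit squares with integer corners. A Dyck tile is a ribbon (finite set of cells) such that the centers of its cells are the lattice points of a translate of a Dyck path (length $0$ allowed, giving a single cell). For Dyck paths $\lambda,\mu$ of length $2N$ with $\mu$ weakly above $\lambda$, a Dyck tiling of $\lambda/\mu$ is a tiling $D$ by Dyck tiles of the region between $\lambda$ and $\mu$ such that if $\eta$ is a tile of $D$, then the translate of $\eta$ by $(1,-1)$ is either completely below $\lambda$ or contained in another tile of $D$. For symmetric $\lambda,\mu$, the tiling is symmetric if it is invariant under the reflection along $x+y=N$ (the center line). $\mathcal{D}_{\mathrm{sym}}(\lambda/* )$ is the set of symmetric Dyck tilings with fixed lower path $\lambda$ and arbitrary symmetric upper path. A positive tile is a tile strictly to the left of the center line; a zero tile is a tile that intersects the center line. $\mathrm{tiles}_+(D)$, $\mathrm{tiles}_0(D)$ are the numbers of positive and zero tiles, $\mathrm{area}_+(D)$, $\mathrm{area}_0(D)$ are the total areas of positive and zero tiles, and $$\mathrm{art}_+(D)=\frac{\mathrm{area}_+(D)+\mathrm{tiles}_+(D)}2,\qquad \mathrm{art}_0(D)=\frac{\mathrm{area}_0(D)+\mathrm{tiles}_0(D)}2 .$$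
   Formalization: The area of zero tiles, area_0(D), counts only the cells on or to the left of the center line; with the total area of the zero tiles the identity for k=0 fails, e.g. for the zigzag path with n=2. *)

theory Defs
  imports Complex_Main
begin

section \<open>Symmetric plane forests\<close>

datatype ptree = Node (subtrees: "ptree list")

type_synonym pforest = "ptree list"

primrec tree_size :: "ptree \<Rightarrow> nat" where
  "tree_size (Node ts) = Suc (sum_list (map tree_size ts))"

definition forest_size :: "pforest \<Rightarrow> nat" where
  "forest_size F = sum_list (map tree_size F)"

primrec mirror_tree :: "ptree \<Rightarrow> ptree" where
  "mirror_tree (Node ts) = Node (rev (map mirror_tree ts))"

definition mirror :: "pforest \<Rightarrow> pforest" where
  "mirror F = rev (map mirror_tree F)"

definition symmetric_forest :: "pforest \<Rightarrow> bool" where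
  "symmetric_forest F \<longleftrightarrow> mirror F = F"

text \<open>
  In a symmetric forest the center line meets a root exactly if the number of roots is odd;
  that root is then the middle one, and the center line is also the symmetry axis of the
  forest of its proper descendants.
\<close>

function center_vertices :: "pforest \<Rightarrow> nat" where
  "center_vertices F =
     (if odd (length F) then Suc (center_vertices (subtrees (F ! (length F div 2)))) else 0)"
  by pat_completeness auto

function left_part :: "pforest \<Rightarrow> pforest" where
  "left_part F = take (length F div 2) F @
     (if odd (length F) then [Node (left_part (subtrees (F ! (length F div 2))))] else [])"
  by pat_completeness auto

lemma size_subtrees_middle:
  assumes "odd (length F)"
  shows "size_list size (subtrees (F ! (length F div 2))) < size_list size F"
proof -
  let ?t = "F ! (length F div 2)"
  have "length F div 2 < length F" using assms by (cases F) auto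
  then have "?t \<in> set F" by simp
  then have "size ?t \<le> size_list size F" by (rule size_list_estimation') simp
  moreover have "size_list size (subtrees ?t) < size ?t" by (cases ?t) simp
  ultimately show ?thesis by simp
qed

termination center_vertices
  by (relation "measure (size_list size)") (simp_all add: size_subtrees_middle)

termination left_part
  by (relation "measure (size_list size)") (simp_all add: size_subtrees_middle)

declare center_vertices.simps [simp del] left_part.simps [simp del]

text \<open>
  The hook lengths of all vertices of a forest, in preorder and with repetitions: the
  descendants of a vertex, itself included, form the subtree hanging at it.
\<close>

primrec tree_hooks :: "ptree \<Rightarrow> nat list" where
  "tree_hooks (Node ts) = tree_size (Node ts) # concat (map tree_hooks ts)"

definition hooks :: "pforest \<Rightarrow> nat list" where
  "hooks F = concat (map tree_hooks F)"

section \<open>Dyck paths\<close>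

datatype step = Up | Down

type_synonym point = "int \<times> int"

text \<open>Up is the step (0,1), Down is the step (1,0), and paths start at (0,0).\<close>

definition point_at :: "step list \<Rightarrow> nat \<Rightarrow> point" where
  "point_at w i = (int (count_list (take i w) Down), int (count_list (take i w) Up))"

definition points :: "step list \<Rightarrow> point set" where
  "points w = point_at w ` {0..length w}"

definition dyck_path :: "nat \<Rightarrow> step list \<Rightarrow> bool" where
  "dyck_path N w \<longleftrightarrow> length w = 2 * N \<and> point_at w (2 * N) = (int N, int N) \<and>
     (\<forall>(x, y) \<in> points w. x \<le> y)"

primrec tree_path :: "ptree \<Rightarrow> step list" where
  "tree_path (Node ts) = Up # concat (map tree_path ts) @ [Down]"

definition forest_path :: "pforest \<Rightarrow> step list" where
  "forest_path F = concat (map tree_path F)"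

text \<open>Reflection along the center line \<open>x + y = N\<close>.\<close>

definition reflect_point :: "nat \<Rightarrow> point \<Rightarrow> point" where
  "reflect_point N = (\<lambda>(x, y). (int N - y, int N - x))"

definition symmetric_path :: "nat \<Rightarrow> step list \<Rightarrow> bool" where
  "symmetric_path N w \<longleftrightarrow> reflect_point N ` points w = points w"

definition weakly_above :: "step list \<Rightarrow> step list \<Rightarrow> bool" where
  "weakly_above mu lam \<longleftrightarrow>
     (\<forall>i. count_list (take i lam) Up \<le> count_list (take i mu) Up)"

section \<open>Symmetric Dyck tilings\<close>

text \<open>The cell \<open>(i, j)\<close> is the unit square \<open>[i, i + 1] \<times> [j, j + 1]\<close>.\<close>

type_synonym cell = "int \<times> int"

definition below_path :: "step list \<Rightarrow> cell \<Rightarrow> bool" where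
  "below_path w = (\<lambda>(i, j). \<exists>(x, y) \<in> points w. x \<le> i \<and> j + 1 \<le> y)"

definition above_path :: "step list \<Rightarrow> cell \<Rightarrow> bool" where
  "above_path w = (\<lambda>(i, j). \<exists>(x, y) \<in> points w. i + 1 \<le> x \<and> y \<le> j)"

definition region :: "step list \<Rightarrow> step list \<Rightarrow> cell set" where
  "region lam mu = {c. above_path lam c \<and> below_path mu c}"

text \<open>
  Cell centers and lower left corners differ by a fixed translation. Cells placed along a
  lattice path automatically form a ribbon.
\<close>

definition dyck_tile :: "cell set \<Rightarrow> bool" where
  "dyck_tile \<eta> \<longleftrightarrow>
     (\<exists>m w a b. dyck_path m w \<and> \<eta> = (\<lambda>(x, y). (a + x, b + y)) ` points w)"

definition shift :: "cell set \<Rightarrow> cell set" where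
  "shift \<eta> = (\<lambda>(i, j). (i + 1, j - 1)) ` \<eta>"

definition dyck_tiling :: "step list \<Rightarrow> step list \<Rightarrow> cell set set \<Rightarrow> bool" where
  "dyck_tiling lam mu D \<longleftrightarrow>
     (\<forall>\<eta> \<in> D. dyck_tile \<eta>) \<and>
     (\<forall>\<eta> \<in> D. \<forall>\<eta>' \<in> D. \<eta> \<noteq> \<eta>' \<longrightarrow> \<eta> \<inter> \<eta>' = {}) \<and>
     \<Union>D = region lam mu \<and>
     (\<forall>\<eta> \<in> D. (\<forall>c \<in> shift \<eta>. below_path lam c) \<or> (\<exists>\<eta>' \<in> D - {\<eta>}. shift \<eta> \<subseteq> \<eta>'))"

text \<open>The action of the reflection on cells, given by their lower left corners.\<close>

definition reflect_cell :: "nat \<Rightarrow> cell \<Rightarrow> cell" where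
  "reflect_cell N = (\<lambda>(i, j). (int N - 1 - j, int N - 1 - i))"

definition symmetric_tiling :: "nat \<Rightarrow> cell set set \<Rightarrow> bool" where
  "symmetric_tiling N D \<longleftrightarrow> (\<lambda>\<eta>. reflect_cell N ` \<eta>) ` D = D"

text \<open>A tiling determines its upper path, so the latter need not be recorded.\<close>

definition Dsym :: "nat \<Rightarrow> step list \<Rightarrow> cell set set set" where
  "Dsym N lam = {D. \<exists>mu. dyck_path N mu \<and> symmetric_path N mu \<and> weakly_above mu lam \<and>
                     dyck_tiling lam mu D \<and> symmetric_tiling N D}"

text \<open>
  The center of the cell \<open>(i, j)\<close> satisfies \<open>x + y = i + j + 1\<close>. A cell touching the center
  line only in a corner counts as lying strictly on one side of it.
\<close>

definition left_of_center :: "nat \<Rightarrow> cell \<Rightarrow> bool" where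
  "left_of_center N = (\<lambda>(i, j). i + j + 1 < int N)"

definition on_center :: "nat \<Rightarrow> cell \<Rightarrow> bool" where
  "on_center N = (\<lambda>(i, j). i + j + 1 = int N)"

definition positive_tiles :: "nat \<Rightarrow> cell set set \<Rightarrow> cell set set" where
  "positive_tiles N D = {\<eta> \<in> D. \<forall>c \<in> \<eta>. left_of_center N c}"

definition zero_tiles :: "nat \<Rightarrow> cell set set \<Rightarrow> cell set set" where
  "zero_tiles N D = {\<eta> \<in> D. \<exists>c \<in> \<eta>. on_center N c}"

definition tiles_plus :: "nat \<Rightarrow> cell set set \<Rightarrow> nat" where
  "tiles_plus N D = card (positive_tiles N D)"

definition tiles_zero :: "nat \<Rightarrow> cell set set \<Rightarrow> nat" where
  "tiles_zero N D = card (zero_tiles N D)"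

definition area_plus :: "nat \<Rightarrow> cell set set \<Rightarrow> nat" where
  "area_plus N D = (\<Sum>\<eta> \<in> positive_tiles N D. card \<eta>)"

text \<open>
  As with the left part of a forest, only the cells on or to the left of the center line
  count towards the area of a zero tile. Counting all its cells would make the generating
  function identity fail: for the zigzag path with \<open>N = 4\<close>, the tiling by the single
  five-cell zero tile must have weight \<open>t q\<^sup>2\<close>, not \<open>t q\<^sup>3\<close>.
\<close>

definition area_zero :: "nat \<Rightarrow> cell set set \<Rightarrow> nat" where
  "area_zero N D =
     (\<Sum>\<eta> \<in> zero_tiles N D. card {c \<in> \<eta>. left_of_center N c \<or> on_center N c})"

text \<open>
  Every Dyck tile has an odd number of cells. Without center vertices, every zero tile also
  has an odd number of cells on or to the left of the center line, so that both quotients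
  are then exact.
\<close>

definition art_plus :: "nat \<Rightarrow> cell set set \<Rightarrow> nat" where
  "art_plus N D = (area_plus N D + tiles_plus N D) div 2"

definition art_zero :: "nat \<Rightarrow> cell set set \<Rightarrow> nat" where
  "art_zero N D = (area_zero N D + tiles_zero N D) div 2"

section \<open>q-analogues\<close>

definition qint :: "'a::comm_ring_1 \<Rightarrow> nat \<Rightarrow> 'a" where
  "qint q m = (\<Sum>i<m. q ^ i)"

definition qfact :: "'a::comm_ring_1 \<Rightarrow> nat \<Rightarrow> 'a" where
  "qfact q m = (\<Prod>i = 1..m. qint q i)"

end

theory Submission
  imports Defs
begin

text \<open>
  Moving a tile along (1,-1) lands inside another tile until it drops below the lower path
  \<open>\<lambda>\<close>. Hence every tile is a translate of a piece of \<open>\<lambda>\<close> between two points of equal height,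
  and a tiling consists of layers of such pieces, every piece lying inside a piece of the layer
  below (lemmas \<open>tile_level\<close> and \<open>flat_tile\<close>). It is therefore determined by two families of
  numbers: for every point of \<open>\<lambda>\<close> the number of layers of cells over it, and for every step of
  \<open>\<lambda>\<close> the number of layers in which the cells over its two end points lie in the same tile,
  called its cut; by nestedness these are the lowest layers. All tiles have the shape of Dyck
  paths if and only if an up step and its matching down step have the same cut and no step
  between them has a smaller one. A symmetric tiling is determined by its left half, so that
  the set of symmetric tilings is in bijection with such codes for the left half of \<open>\<lambda>\<close> (lemma
  \<open>tiling_of_bij\<close>). Under the bijection \<open>tiles\<^sub>0\<close> is the number of layers over the last
  point, and if no vertex lies on the center line, \<open>art\<^sub>+ + art\<^sub>0\<close> is the sum of all numbers of
  layers after the starting point minus the sum of the cuts of the up steps.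

  Codes are counted with a transfer operator. The codes over the path of a forest \<open>F\<close> that
  start with \<open>i\<close> layers and end with \<open>j\<close> layers form the entry \<open>(i, j)\<close> of a matrix, and
  juxtaposing forests multiplies the matrices. Let \<open>X\<close> be the matrix of a single vertex. The
  crucial fact is that the matrix of \<open>F\<close>, multiplied by the product of all \<open>[h\<^sub>x]\<^sub>q\<close>, equals
  \<open>X\<^sup>n\<close> with \<open>n\<close> the size of \<open>F\<close> (lemma \<open>hooks_forest_op\<close>): the shape of \<open>F\<close> enters only
  through its hook lengths. By induction this reduces to putting a root above a forest whose
  matrix is \<open>X\<^sup>n\<close>, which must give \<open>X\<^sup>n\<^sup>+\<^sup>1\<close> divided by \<open>[n+1]\<^sub>q\<close>. The cut of the root is summed
  over, and subtracting the shifted sum leaves one term; the resulting identity (lemma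
  \<open>leaf_pow_telescope\<close>) follows from \<open>q\<close>-commutation relations between \<open>X\<close>, the matrix of
  an up step and the shift.

  Finally, row 0 of \<open>X\<^sup>n\<close> applied to a geometric sequence evaluates to \<open>[n]\<^sub>q!\<close> times a product
  of \<open>n\<close> linear factors (lemma \<open>leaf_pow_geometric\<close>), which for the sequence \<open>(tq)\<^sup>j\<close> is the
  weighted formula. For the number of tilings \<open>q = 1\<close> and the sequence is constant; the down
  step of a vertex off the center line doubles a constant sequence, while a center vertex
  has no down step in the left half, so that each center vertex loses a factor 2 (lemma
  \<open>code_gf_half_path\<close>).
\<close>

section \<open>The operator of a leaf\<close>

text \<open>
  The operators act on sequences \<open>f\<close> indexed by the number of layers over the end point of a
  piece of path; the result is indexed by the number of layers over its starting point. With
  every step the number of layers over its starting point is recorded as a power of \<open>q\<close>. Over an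
  up step the number of layers stays or drops by one, over a down step it stays or grows by one.
\<close>
definition shift_op :: "(nat \<Rightarrow> 'a) \<Rightarrow> nat \<Rightarrow> 'a::comm_ring_1" where
  "shift_op f i = (if i = 0 then 0 else f (i - 1))"

definition up_op :: "'a \<Rightarrow> (nat \<Rightarrow> 'a) \<Rightarrow> nat \<Rightarrow> 'a::comm_ring_1" where
  "up_op q f i = q ^ i * (f i + shift_op f i)"

definition down_op :: "'a \<Rightarrow> (nat \<Rightarrow> 'a) \<Rightarrow> nat \<Rightarrow> 'a::comm_ring_1" where
  "down_op q f i = q ^ i * (f i + f (Suc i))"

text \<open>
  The operator of the path \<open>Up, Down\<close>, with the sum over the common cut of its two steps carried
  out; this sum produces the \<open>q\<close>-integers.
\<close>
definition leaf_op :: "'a \<Rightarrow> (nat \<Rightarrow> 'a) \<Rightarrow> nat \<Rightarrow> 'a::comm_ring_1" where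
  "leaf_op q f i = q ^ i * (qint q i * f (i - 1) + (qint q (Suc i) + qint q i) * f i
                            + qint q (Suc i) * f (Suc i))"

lemma qint_0 [simp]: "qint q 0 = 0"
  by (simp add: qint_def)

lemma qint_Suc: "qint q (Suc n) = 1 + q * qint q n"
  unfolding qint_def by (subst sum.lessThan_Suc_shift) (simp add: sum_distrib_left)

lemma qint_Suc': "qint q (Suc n) = qint q n + q ^ n"
  by (simp add: qint_def)

lemma qint_add_power: "1 + q * qint q n = qint q n + q ^ n"
  using qint_Suc[of q n] qint_Suc'[of q n] by simp

lemma leaf_op_lincomb:
  "leaf_op q (\<lambda>i. a * f i + b * g i) = (\<lambda>i. a * leaf_op q f i + b * leaf_op q g i)"
  by (rule ext) (simp add: leaf_op_def algebra_simps)

lemma leaf_op_pow_lincomb: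
  "(leaf_op q ^^ n) (\<lambda>i. a * f i + b * g i)
     = (\<lambda>i. a * (leaf_op q ^^ n) f i + b * (leaf_op q ^^ n) g i)"
  by (induction n) (simp_all add: leaf_op_lincomb)

lemma up_op_lincomb:
  "up_op q (\<lambda>i. a * f i + b * g i) = (\<lambda>i. a * up_op q f i + b * up_op q g i)"
  by (rule ext) (simp add: up_op_def shift_op_def algebra_simps)

lemma up_op_scale: "up_op q (\<lambda>i. c * f i) = (\<lambda>i. c * up_op q f i)"
  by (rule ext) (simp add: up_op_def shift_op_def algebra_simps)

text \<open>
  This relation and the next make the powers of the leaf operator computable: up to a factor
  \<open>q\<close>, commuting it past an up step or past the shift costs the same error term, two up steps.
\<close>
lemma leaf_up: "leaf_op q (up_op q f) i = q * up_op q (leaf_op q f) i + up_op q (up_op q f) i"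
proof (cases i)
  case 0
  then show ?thesis by (simp add: leaf_op_def up_op_def shift_op_def qint_Suc algebra_simps)
next
  case (Suc j)
  show ?thesis
  proof (cases j)
    case 0
    then show ?thesis using Suc
      by (simp add: leaf_op_def up_op_def shift_op_def qint_Suc algebra_simps)
  next
    case (Suc k)
    have p: "q ^ j = 1 + q * qint q j - qint q j" for j
      using qint_add_power[of q j] by simp
    show ?thesis using Suc \<open>i = Suc j\<close>
      by (simp add: leaf_op_def up_op_def shift_op_def qint_Suc p algebra_simps)
  qed
qed

lemma leaf_shift: "leaf_op q (shift_op f) i = q * shift_op (leaf_op q f) i + up_op q (up_op q f) i"
proof (cases i)
  case 0
  then show ?thesis by (simp add: leaf_op_def up_op_def shift_op_def qint_Suc algebra_simps)
next
  case (Suc j)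
  have p: "q ^ j = 1 + q * qint q j - qint q j" for j
    using qint_add_power[of q j] by simp
  show ?thesis
  proof (cases j)
    case 0
    then show ?thesis using Suc
      by (simp add: leaf_op_def up_op_def shift_op_def qint_Suc algebra_simps)
  next
    case (Suc k)
    show ?thesis using Suc \<open>i = Suc j\<close>
      by (simp add: leaf_op_def up_op_def shift_op_def qint_Suc p algebra_simps)
  qed
qed

lemma leaf_op_down: "leaf_op q f i - q * shift_op (leaf_op q (f \<circ> Suc)) i = up_op q (down_op q f) i"
proof (cases i)
  case 0
  then show ?thesis by (simp add: leaf_op_def up_op_def down_op_def shift_op_def qint_Suc algebra_simps)
next
  case (Suc j)
  have p: "q ^ j = 1 + q * qint q j - qint q j" for j
    using qint_add_power[of q j] by simp
  show ?thesis using Suc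
      by (cases j) (simp_all add: leaf_op_def up_op_def down_op_def shift_op_def qint_Suc p algebra_simps)
qed
text \<open>
  Since the error terms agree, the leaf operator \<open>q\<close>-commutes exactly with the difference of shift
  and up step.
\<close>
definition defect_op :: "'a \<Rightarrow> (nat \<Rightarrow> 'a) \<Rightarrow> nat \<Rightarrow> 'a::comm_ring_1" where
  "defect_op q f i = shift_op f i - up_op q f i"

lemma leaf_defect: "leaf_op q (defect_op q f) = (\<lambda>i. q * defect_op q (leaf_op q f) i)"
proof
  fix i
  have "leaf_op q (defect_op q f) i = leaf_op q (shift_op f) i - leaf_op q (up_op q f) i"
    using leaf_op_lincomb[of q 1 "shift_op f" "-1" "up_op q f"]
    by (simp add: defect_op_def[abs_def])
  then show "leaf_op q (defect_op q f) i = q * defect_op q (leaf_op q f) i"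
    by (simp add: leaf_shift leaf_up defect_op_def algebra_simps)
qed

lemma leaf_pow_defect:
  "(leaf_op q ^^ n) (defect_op q f) = (\<lambda>i. q ^ n * defect_op q ((leaf_op q ^^ n) f) i)"
proof (induction n)
  case (Suc n)
  have "leaf_op q (\<lambda>i. q ^ n * defect_op q ((leaf_op q ^^ n) f) i)
      = (\<lambda>i. q ^ n * leaf_op q (defect_op q ((leaf_op q ^^ n) f)) i)"
    using leaf_op_lincomb[of q "q ^ n" _ 0 "\<lambda>_. 0"] by simp
  then show ?case using Suc by (simp add: leaf_defect algebra_simps)
qed simp

text \<open>
  The defect of a sequence without its first entry compares the sequence with its image under a
  down step. At index 0 this relies on the weight \<open>q\<^sup>0 = 1\<close>.
\<close>
lemma defect_tail: "defect_op q (f \<circ> Suc) i = f i - down_op q f i"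
  by (cases i) (simp_all add: defect_op_def shift_op_def up_op_def down_op_def algebra_simps)

text \<open>
  A root over \<open>n\<close> vertices contributes a geometric sum of shifted copies of the right-hand side,
  one for each value of its cut. The identity says that this sum telescopes to the next power of
  the leaf operator. In the induction, one leaf operator is moved to the right through the shift and the up
  step; the error terms combine by the induction hypothesis and \<open>leaf_pow_defect\<close>.
\<close>
lemma leaf_pow_telescope:
  "(leaf_op q ^^ Suc n) f i - q ^ Suc n * shift_op ((leaf_op q ^^ Suc n) (f \<circ> Suc)) i
     = qint q (Suc n) * up_op q ((leaf_op q ^^ n) (down_op q f)) i"
proof (induction n arbitrary: i)
  case 0
  then show ?case using leaf_op_down[of q f i] by (simp add: qint_Suc o_def)
next
  case (Suc n)
  define X where "X = leaf_op q"
  define A where "A = (X ^^ Suc n) f"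
  define B where "B = (X ^^ Suc n) (f \<circ> Suc)"
  define C where "C = (X ^^ n) (down_op q f)"
  define c where "c = qint q (Suc n)"
  have IH: "A = (\<lambda>i. q ^ Suc n * shift_op B i + c * up_op q C i)"
    using Suc.IH by (auto simp: fun_eq_iff A_def B_def C_def c_def X_def o_def algebra_simps)
  have XA: "X A j = q ^ Suc n * (q * shift_op (X B) j + up_op q (up_op q B) j)
                  + c * (q * up_op q (X C) j + up_op q (up_op q C) j)" for j
    by (subst IH) (simp add: X_def leaf_op_lincomb leaf_shift leaf_up)
  \<comment> \<open>By the induction hypothesis the left-hand side is the leaf power of f up to a defect.\<close>
  have bracket: "q ^ Suc n * up_op q B j + c * up_op q C j = X C j" for j
  proof -
    have "q ^ Suc n * up_op q B j + c * up_op q C j = A j - q ^ Suc n * defect_op q B j"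
      by (subst IH) (simp add: defect_op_def algebra_simps)
    also have "q ^ Suc n * defect_op q B j = (X ^^ Suc n) (defect_op q (f \<circ> Suc)) j"
      by (simp only: B_def X_def leaf_pow_defect)
    also have "defect_op q (f \<circ> Suc) = (\<lambda>i. 1 * f i + (- 1) * down_op q f i)"
      by (auto simp: defect_tail)
    also have "(X ^^ Suc n) (\<lambda>i. 1 * f i + (- 1) * down_op q f i) j
                = A j - (X ^^ Suc n) (down_op q f) j"
      by (simp only: X_def leaf_op_pow_lincomb A_def)
         (simp only: mult_1 mult_minus1 diff_conv_add_uminus)
    finally show ?thesis by (simp add: C_def)
  qed
  have bracket_fun: "(\<lambda>j. q ^ Suc n * up_op q B j + c * up_op q C j) = X C"
    by (rule ext) (rule bracket)
  have "X A i - q ^ Suc (Suc n) * shift_op (X B) i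
      = up_op q (\<lambda>j. q ^ Suc n * up_op q B j + c * up_op q C j) i + c * q * up_op q (X C) i"
    by (simp add: XA up_op_lincomb[of q "q ^ Suc n"] del: power_Suc) (simp add: algebra_simps)
  also have "\<dots> = (1 + q * c) * up_op q (X C) i"
    unfolding bracket_fun by (simp add: algebra_simps)
  finally show ?case
    by (simp add: A_def B_def C_def c_def X_def qint_Suc[of q "Suc n"] o_def)
qed

text \<open>
  At index 0 the shifted term of the telescoping identity vanishes and the up step is trivial,
  while a down step turns the geometric sequence of ratio \<open>x\<close> into \<open>1 + x\<close> times the one of
  ratio \<open>q x\<close>.
\<close>
lemma leaf_pow_geometric:
  "(leaf_op q ^^ n) (\<lambda>j. x ^ j) 0 = qfact q n * (\<Prod>i<n. 1 + q ^ i * x)"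
proof (induction n arbitrary: x)
  case 0
  then show ?case by (simp add: qfact_def)
next
  case (Suc n)
  have d: "down_op q (\<lambda>j. x ^ j) = (\<lambda>j. (1 + x) * (q * x) ^ j + 0 * 0)"
    by (simp add: fun_eq_iff down_op_def power_mult_distrib algebra_simps)
  have "(leaf_op q ^^ Suc n) (\<lambda>j. x ^ j) 0
          = qint q (Suc n) * (leaf_op q ^^ n) (down_op q (\<lambda>j. x ^ j)) 0"
    using leaf_pow_telescope[where q = q and n = n and f = "\<lambda>j. x ^ j" and i = 0] by (simp add: shift_op_def up_op_def)
  also have "(leaf_op q ^^ n) (down_op q (\<lambda>j. x ^ j)) 0
          = (1 + x) * (leaf_op q ^^ n) (\<lambda>j. (q * x) ^ j) 0"
    unfolding d leaf_op_pow_lincomb by simp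
  also have "\<dots> = (1 + x) * (qfact q n * (\<Prod>i<n. 1 + q ^ i * (q * x)))"
    by (simp only: Suc.IH)
  also have "qint q (Suc n) * \<dots> = qfact q (Suc n) * (\<Prod>i<Suc n. 1 + q ^ i * x)"
    unfolding prod.lessThan_Suc_shift by (simp add: qfact_def algebra_simps)
  finally show ?case .
qed

section \<open>The operator of a forest\<close>

text \<open>
  Putting a root over a forest with \<open>n\<close> vertices and operator \<open>M\<close>. The summation index \<open>r\<close> is the
  cut of the root: the lowest \<open>r\<close> layers are joined along the whole tree, and removing them lowers
  all layers and cuts by \<open>r\<close>, which costs \<open>q\<^sup>r\<close> for every vertex of the tree.
\<close>
definition nest_op :: "'a \<Rightarrow> nat \<Rightarrow> ((nat \<Rightarrow> 'a) \<Rightarrow> nat \<Rightarrow> 'a) \<Rightarrow> (nat \<Rightarrow> 'a) \<Rightarrow> nat \<Rightarrow> 'a::comm_ring_1"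
  where "nest_op q n M f i =
     (\<Sum>r\<le>i. q ^ (r * Suc n) * up_op q (M (down_op q (\<lambda>j. f (r + j)))) (i - r))"

text \<open>
  Splitting off the term \<open>r = 0\<close> of the sum leaves \<open>q\<^sup>n\<^sup>+\<^sup>1\<close> times the same sum for the sequence
  without its first entry, so the telescoping identity applies.
\<close>
lemma nest_op_leaf_pow:
  "qint q (Suc n) * nest_op q n (leaf_op q ^^ n) f i = (leaf_op q ^^ Suc n) f i"
proof (induction i arbitrary: f)
  case 0
  then show ?case using leaf_pow_telescope[where q = q and n = n and f = f and i = 0]
    by (simp add: nest_op_def shift_op_def)
next
  case (Suc i)
  have "nest_op q n (leaf_op q ^^ n) f (Suc i) = up_op q ((leaf_op q ^^ n) (down_op q f)) (Suc i)
          + q ^ Suc n * nest_op q n (leaf_op q ^^ n) (f \<circ> Suc) i"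
    unfolding nest_op_def sum.atMost_Suc_shift
    by (simp add: sum_distrib_left power_add algebra_simps)
  then have "qint q (Suc n) * nest_op q n (leaf_op q ^^ n) f (Suc i)
      = qint q (Suc n) * up_op q ((leaf_op q ^^ n) (down_op q f)) (Suc i)
          + q ^ Suc n * (leaf_op q ^^ Suc n) (f \<circ> Suc) i"
    by (simp only: Suc.IH[symmetric]) (simp add: o_def algebra_simps)
  then show ?case using leaf_pow_telescope[where q = q and n = n and f = f and i = "Suc i"]
    by (simp add: shift_op_def diff_eq_eq)
qed

fun forest_op :: "'a \<Rightarrow> pforest \<Rightarrow> (nat \<Rightarrow> 'a) \<Rightarrow> nat \<Rightarrow> 'a::comm_ring_1" where
  "forest_op q [] f = f"
| "forest_op q (Node G # F) f = nest_op q (forest_size G) (forest_op q G) (forest_op q F f)"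

lemma forest_size_simps [simp]:
  "forest_size [] = 0"
  "forest_size (Node G # F) = Suc (forest_size G) + forest_size F"
  "forest_size (F @ G) = forest_size F + forest_size G"
  by (simp_all add: forest_size_def)

lemma hooks_simps [simp]:
  "hooks [] = []"
  "hooks (Node G # F) = Suc (forest_size G) # hooks G @ hooks F"
  "hooks (F @ G) = hooks F @ hooks G"
  by (simp_all add: hooks_def forest_size_def)

lemma forest_path_simps [simp]:
  "forest_path [] = []"
  "forest_path (Node G # F) = Up # forest_path G @ Down # forest_path F"
  "forest_path (F @ G) = forest_path F @ forest_path G"
  by (simp_all add: forest_path_def)

text \<open>
  Recursion on the first tree of a forest avoids a simultaneous induction on trees and forests.
\<close>
lemma forest_induct [case_names Nil Node]:
  assumes "P []" "\<And>G F. P G \<Longrightarrow> P F \<Longrightarrow> P (Node G # F)"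
  shows "P F"
  using assms by induction_schema (pat_completeness, lexicographic_order)

lemma length_forest_path [simp]: "length (forest_path F) = 2 * forest_size F"
  by (induction F rule: forest_induct) simp_all

lemma nest_op_cong:
  assumes "\<And>f i. M f i = M' f i"
  shows "nest_op q n M f i = nest_op q n M' f i"
proof -
  have "M = M'" using assms by (intro ext)
  then show ?thesis by simp
qed

lemma nest_op_scale:
  assumes "\<And>c f. M (\<lambda>i. c * f i) = (\<lambda>i. c * M f i)"
  shows "nest_op q n M (\<lambda>i. c * f i) = (\<lambda>i. c * nest_op q n M f i)"
proof
  fix i
  have d: "down_op q (\<lambda>j. c * f (r + j)) = (\<lambda>i. c * down_op q (\<lambda>j. f (r + j)) i)" for r
    by (simp add: fun_eq_iff down_op_def algebra_simps)
  show "nest_op q n M (\<lambda>i. c * f i) i = c * nest_op q n M f i"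
    by (simp add: nest_op_def d assms up_op_scale sum_distrib_left algebra_simps)
qed

lemma nest_op_scale_left: "nest_op q n (\<lambda>f i. c * M f i) f i = c * nest_op q n M f i"
  by (simp add: nest_op_def up_op_scale sum_distrib_left algebra_simps)

lemma forest_op_scale: "forest_op q F (\<lambda>i. c * f i) = (\<lambda>i. c * forest_op q F f i)"
proof (induction F arbitrary: c f rule: forest_induct)
  case (Node G F)
  show ?case by (simp add: Node(2) nest_op_scale[OF Node(1)])
qed simp

lemma leaf_pow_scale: "(leaf_op q ^^ n) (\<lambda>i. c * f i) = (\<lambda>i. c * (leaf_op q ^^ n) f i)"
  using leaf_op_pow_lincomb[of n q c f 0 "\<lambda>_. 0"] by simp

text \<open>
  The forest matters only through its hook lengths and its size. The root of the first tree contributes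
  the factor that turns nesting into one more power of the leaf operator.
\<close>
lemma hooks_forest_op:
  "(\<Prod>h\<leftarrow>hooks F. qint q h) * forest_op q F f i = (leaf_op q ^^ forest_size F) f i"
proof (induction F arbitrary: f i rule: forest_induct)
  case (Node G F)
  let ?a = "\<Prod>h\<leftarrow>hooks G. qint q h" and ?b = "\<Prod>h\<leftarrow>hooks F. qint q h"
  let ?n = "forest_size G"
  have "?a * nest_op q ?n (forest_op q G) g i = nest_op q ?n (leaf_op q ^^ ?n) g i" for g i
    using nest_op_cong[of "\<lambda>f i. ?a * forest_op q G f i" "leaf_op q ^^ ?n", OF Node(1)]
    by (simp add: nest_op_scale_left)
  then have G: "qint q (Suc ?n) * ?a * nest_op q ?n (forest_op q G) g i = (leaf_op q ^^ Suc ?n) g i"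
    for g i by (simp only: mult.assoc nest_op_leaf_pow)
  have F: "(\<lambda>i. ?b * forest_op q F f i) = (leaf_op q ^^ forest_size F) f"
    by (rule ext) (rule Node(2))
  have "(\<Prod>h\<leftarrow>hooks (Node G # F). qint q h) * forest_op q (Node G # F) f i
      = ?b * ((qint q (Suc ?n) * ?a) * nest_op q ?n (forest_op q G) (forest_op q F f) i)"
    by (simp add: algebra_simps)
  also have "\<dots> = ?b * (leaf_op q ^^ Suc ?n) (forest_op q F f) i"
    by (simp only: G)
  also have "\<dots> = (leaf_op q ^^ Suc ?n) (\<lambda>i. ?b * forest_op q F f i) i"
    by (simp only: leaf_pow_scale)
  also have "\<dots> = (leaf_op q ^^ (Suc ?n + forest_size F)) f i"
    by (simp only: F funpow_add comp_apply)
  finally show ?case by simp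
qed simp

section \<open>Codes and their generating functions\<close>

text \<open>
  Codes are read along the path with a stack that holds the cuts of the up steps that are still
  unmatched. The cut of a step must not be smaller than that of any enclosing up step, and since the stack is
  monotone only its top has to be compared.
\<close>
definition top_cut :: "nat list \<Rightarrow> nat" where
  "top_cut st = (case st of [] \<Rightarrow> 0 | s # _ \<Rightarrow> s)"

lemma top_cut_simps [simp]: "top_cut [] = 0" "top_cut (s # st) = s"
  by (simp_all add: top_cut_def)

fun code_gf :: "'a \<Rightarrow> (nat \<Rightarrow> 'a) \<Rightarrow> step list \<Rightarrow> nat list \<Rightarrow> nat \<Rightarrow> 'a::comm_ring_1" where
  "code_gf q f [] st i = f i"
| "code_gf q f (Up # w) st i =
     (\<Sum>h = i - 1..i. \<Sum>c = top_cut st..h. q ^ (i - c) * code_gf q f w (c # st) h)"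
| "code_gf q f (Down # w) [] i = 0"
| "code_gf q f (Down # w) (s # st) i = q ^ i * (code_gf q f w st i + code_gf q f w st (Suc i))"

text \<open>
  The entry \<open>(c, h)\<close> of a code belongs to one step of the path: \<open>c\<close> is the cut of the step and
  \<open>h\<close> the number of layers over its end point; \<open>i\<close> is the number of layers over the starting point. A down
  step repeats the cut of its matching up step.
\<close>
fun admissible :: "step list \<Rightarrow> nat list \<Rightarrow> nat \<Rightarrow> (nat \<times> nat) list \<Rightarrow> bool" where
  "admissible [] st i [] = True"
| "admissible (Up # w) st i ((c, h) # xs) =
     (h \<in> {i - 1..i} \<and> c \<in> {top_cut st..h} \<and> admissible w (c # st) h xs)"
| "admissible (Down # w) (s # st) i ((c, h) # xs) =
     (c = s \<and> h \<in> {i, Suc i} \<and> admissible w st h xs)"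
| "admissible _ _ _ _ = False"

text \<open>
  The cut is subtracted only at up steps: the two steps of a vertex have the same cut, and together they
  lower the number of tiles, hence twice the art statistic, by twice that cut.
\<close>
fun code_weight :: "step list \<Rightarrow> nat \<Rightarrow> (nat \<times> nat) list \<Rightarrow> nat" where
  "code_weight (Up # w) i ((c, h) # xs) = i - c + code_weight w h xs"
| "code_weight (Down # w) i ((c, h) # xs) = i + code_weight w h xs"
| "code_weight _ _ _ = 0"

fun code_end :: "nat \<Rightarrow> (nat \<times> nat) list \<Rightarrow> nat" where
  "code_end i [] = i"
| "code_end i ((c, h) # xs) = code_end h xs"

lemma admissible_sets:
  "{xs. admissible [] st i xs} = {[]}"
  "{xs. admissible (Up # w) st i xs} =
     (\<lambda>(h, c, xs). (c, h) # xs) `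
       (SIGMA h:{i - 1..i}. SIGMA c:{top_cut st..h}. {xs. admissible w (c # st) h xs})"
  "{xs. admissible (Down # w) [] i xs} = {}"
  "{xs. admissible (Down # w) (s # st) i xs} =
     (\<lambda>(h, xs). (s, h) # xs) ` (SIGMA h:{i, Suc i}. {xs. admissible w st h xs})"
proof -
  show "{xs. admissible [] st i xs} = {[]}"
    by (auto elim: admissible.elims)
  show "{xs. admissible (Down # w) [] i xs} = {}"
    by (auto elim: admissible.elims)
  have "admissible (Up # w) st i xs \<longleftrightarrow>
      (\<exists>h c ys. xs = (c, h) # ys \<and> admissible (Up # w) st i ((c, h) # ys))" for xs
    by (auto elim: admissible.elims)
  then show "{xs. admissible (Up # w) st i xs} =
     (\<lambda>(h, c, xs). (c, h) # xs) `
       (SIGMA h:{i - 1..i}. SIGMA c:{top_cut st..h}. {xs. admissible w (c # st) h xs})"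
    unfolding admissible.simps by (auto simp: image_iff Bex_def)
  have "admissible (Down # w) (s # st) i xs \<longleftrightarrow>
      (\<exists>h c ys. xs = (c, h) # ys \<and> admissible (Down # w) (s # st) i ((c, h) # ys))" for xs
    by (auto elim: admissible.elims)
  then show "{xs. admissible (Down # w) (s # st) i xs} =
     (\<lambda>(h, xs). (s, h) # xs) ` (SIGMA h:{i, Suc i}. {xs. admissible w st h xs})"
    unfolding admissible.simps by (auto simp: image_iff Bex_def)
qed

lemma finite_admissible: "finite {xs. admissible w st i xs}"
proof (induction w arbitrary: st i)
  case (Cons s w)
  show ?case
  proof (cases s)
    case Up
    then show ?thesis unfolding Up admissible_sets using Cons by (intro finite_imageI finite_SigmaI) auto
  next
    case Down
    show ?thesis
      by (cases st) (use Cons in \<open>simp_all add: Down admissible_sets\<close>)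
  qed
qed (simp add: admissible_sets)

lemma sum_admissible:
  "(\<Sum>xs | admissible w st i xs. q ^ code_weight w i xs * f (code_end i xs)) = code_gf q f w st i"
proof (induction q f w st i rule: code_gf.induct)
  case (2 q f w st i)
  have "(\<Sum>xs | admissible (Up # w) st i xs. q ^ code_weight (Up # w) i xs * f (code_end i xs))
      = (\<Sum>(h, c, xs)\<in>(SIGMA h:{i - 1..i}. SIGMA c:{top_cut st..h}. {xs. admissible w (c # st) h xs}).
          q ^ (i - c) * (q ^ code_weight w h xs * f (code_end h xs)))"
    unfolding admissible_sets
    by (subst sum.reindex) (auto simp: inj_on_def intro!: sum.cong
        simp flip: power_add mult.assoc)
  also have "\<dots> = (\<Sum>h = i - 1..i. \<Sum>c = top_cut st..h. \<Sum>xs | admissible w (c # st) h xs.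
          q ^ (i - c) * (q ^ code_weight w h xs * f (code_end h xs)))"
    by (simp add: sum.Sigma finite_admissible split_beta)
  also have "\<dots> = code_gf q f (Up # w) st i"
    by (simp add: sum_distrib_left[symmetric] 2)
  finally show ?case .
next
  case (4 q f w s st i)
  have "(\<Sum>xs | admissible (Down # w) (s # st) i xs.
            q ^ code_weight (Down # w) i xs * f (code_end i xs))
      = (\<Sum>(h, xs)\<in>(SIGMA h:{i, Suc i}. {xs. admissible w st h xs}).
          q ^ i * (q ^ code_weight w h xs * f (code_end h xs)))"
    unfolding admissible_sets
    by (subst sum.reindex) (auto simp: inj_on_def intro!: sum.cong
        simp flip: power_add mult.assoc)
  also have "\<dots> = (\<Sum>h\<in>{i, Suc i}. \<Sum>xs | admissible w st h xs.
          q ^ i * (q ^ code_weight w h xs * f (code_end h xs)))"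
    by (subst sum.Sigma) (simp_all add: finite_admissible)
  also have "\<dots> = code_gf q f (Down # w) (s # st) i"
    using 4 by (simp add: sum_distrib_left[symmetric] distrib_left)
  finally show ?case .
qed (simp_all add: admissible_sets)

lemma sum_from_offset: "(\<Sum>c = b..b + m. g c) = (\<Sum>r\<le>m. g (b + r :: nat))"
  using sum.shift_bounds_cl_nat_ivl[of g 0 b m] by (simp add: atMost_atLeast0 add.commute)

text \<open>
  In terms of the layers above the current cut, the cut of an up step is an arbitrary number \<open>r\<close> of
  further layers, and what follows is read relative to the new cut.
\<close>
lemma code_gf_Up:
  "code_gf q f (Up # w) st (top_cut st + i) =
     (\<Sum>r\<le>i. up_op q (\<lambda>j. code_gf q f w ((top_cut st + r) # st) (top_cut st + r + j)) (i - r))"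
proof (cases i)
  case 0
  show ?thesis
  proof (cases "top_cut st")
    case (Suc b)
    have "{b..Suc b} = {b, Suc b}" by auto
    then show ?thesis using 0 Suc by (simp add: up_op_def shift_op_def)
  qed (simp add: 0 up_op_def shift_op_def)
next
  case (Suc k)
  let ?b = "top_cut st"
  let ?g = "\<lambda>h c. q ^ (?b + i - c) * code_gf q f w (c # st) h"
  have "{?b + k..?b + i} = {?b + k, ?b + i}" using Suc by auto
  then have "code_gf q f (Up # w) st (?b + i)
      = (\<Sum>c = ?b..?b + k. ?g (?b + k) c) + (\<Sum>c = ?b..?b + i. ?g (?b + i) c)"
    using Suc by simp
  also have "\<dots> = (\<Sum>r\<le>k. ?g (?b + k) (?b + r)) + (\<Sum>r\<le>i. ?g (?b + i) (?b + r))"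
    by (simp only: sum_from_offset)
  also have "\<dots> = (\<Sum>r\<le>k. ?g (?b + k) (?b + r) + ?g (?b + i) (?b + r)) + ?g (?b + i) (?b + i)"
    by (simp add: Suc sum.distrib)
  also have "(\<Sum>r\<le>k. ?g (?b + k) (?b + r) + ?g (?b + i) (?b + r))
      = (\<Sum>r\<le>k. up_op q (\<lambda>j. code_gf q f w ((?b + r) # st) (?b + r + j)) (i - r))"
    using Suc by (intro sum.cong) (auto simp: up_op_def shift_op_def Suc_diff_le algebra_simps)
  finally show ?thesis by (simp add: Suc up_op_def shift_op_def)
qed

text \<open>
  Below the cut on top of the stack all tiles run through the whole forest. These
  \<open>top_cut st\<close> layers contribute a power of \<open>q\<close> for every vertex, and the layers above them obey the
  operator of the forest.
\<close>
lemma code_gf_forest: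
  "code_gf q f (forest_path F @ w) st (top_cut st + i) =
     q ^ (top_cut st * forest_size F) *
       forest_op q F (\<lambda>j. code_gf q f w st (top_cut st + j)) i"
proof (induction F arbitrary: w st i rule: forest_induct)
  case (Node G F)
  let ?b = "top_cut st" and ?n = "forest_size G"
  let ?g = "forest_op q F (\<lambda>j. code_gf q f w st (?b + j))"
  let ?B = "q ^ (?b * forest_size F)"
  have F: "code_gf q f (forest_path F @ w) st (?b + r + j) = ?B * ?g (r + j)" for r j
    using Node(2)[of w st "r + j"] by (simp add: add.assoc)
  have down: "(\<lambda>j. code_gf q f (Down # forest_path F @ w) ((?b + r) # st) (?b + r + j))
      = (\<lambda>j. q ^ (?b + r) * ?B * down_op q (\<lambda>j. ?g (r + j)) j)" for r
    using F[of r] F[of r "Suc _"] by (simp add: fun_eq_iff down_op_def power_add distrib_left mult.left_commute)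
  have inner: "code_gf q f (forest_path G @ Down # forest_path F @ w) ((?b + r) # st) (?b + r + j)
      = q ^ ((?b + r) * Suc ?n) * ?B * forest_op q G (down_op q (\<lambda>j. ?g (r + j))) j" for r j
    using Node(1)[of "Down # forest_path F @ w" "(?b + r) # st" j]
    unfolding top_cut_simps down forest_op_scale by (simp add: power_add mult_ac)
  have "code_gf q f (forest_path (Node G # F) @ w) st (?b + i) =
      (\<Sum>r\<le>i. q ^ ((?b + r) * Suc ?n) * ?B *
              up_op q (forest_op q G (down_op q (\<lambda>j. ?g (r + j)))) (i - r))"
    by (simp only: forest_path_simps append_Cons append_assoc code_gf_Up inner up_op_scale)
  then show ?case
    by (simp add: nest_op_def sum_distrib_left power_add algebra_simps)
qed simp

section \<open>The left half of a symmetric forest\<close>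

lemma mirror_simps [simp]:
  "mirror [] = []"
  "mirror (Node G # F) = mirror F @ [Node (mirror G)]"
  "mirror (F @ G) = mirror G @ mirror F"
  by (simp_all add: mirror_def)

lemma length_mirror [simp]: "length (mirror F) = length F"
  by (simp add: mirror_def)

lemma forest_size_mirror [simp]: "forest_size (mirror F) = forest_size F"
  by (induction F rule: forest_induct) simp_all

lemma symmetric_forest_decomp:
  assumes "symmetric_forest F"
  defines "A \<equiv> take (length F div 2) F" and "t \<equiv> F ! (length F div 2)"
  shows "even (length F) \<Longrightarrow> F = A @ mirror A"
    and "odd (length F) \<Longrightarrow> F = A @ t # mirror A"
    and "odd (length F) \<Longrightarrow> symmetric_forest (subtrees t)"
proof -
  let ?m = "length F div 2"
  have F: "mirror F = F" using assms(1) by (simp add: symmetric_forest_def)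
  have drop: "drop (length F - ?m) F = mirror A"
    using F unfolding mirror_def A_def
    by (metis length_map rev_take take_map length_rev diff_diff_cancel div_le_dividend rev_drop rev_rev_ident)
  show "F = A @ mirror A" if "even (length F)"
  proof -
    have "length F - ?m = ?m" using that by auto
    then show ?thesis using drop by (metis A_def append_take_drop_id)
  qed
  assume odd: "odd (length F)"
  have e: "length F - ?m = Suc ?m" using odd by presburger
  have lt: "?m < length F" using odd by (cases F) auto
  show "F = A @ t # mirror A"
    using drop e lt by (metis A_def t_def id_take_nth_drop)
  have "t = mirror F ! ?m" by (simp add: F t_def)
  also have "\<dots> = mirror_tree (F ! (length F - Suc ?m))"
    using lt by (simp add: mirror_def rev_nth)
  also have "length F - Suc ?m = ?m" using e by simp
  finally have "mirror_tree t = t" by (simp add: t_def)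
  then show "symmetric_forest (subtrees t)"
    by (cases t) (simp add: symmetric_forest_def mirror_def)
qed

definition half_path :: "pforest \<Rightarrow> step list" where
  "half_path F = take (forest_size F) (forest_path F)"

lemma half_path_even:
  assumes "symmetric_forest F" "even (length F)"
  shows "half_path F = forest_path (left_part F)"
proof -
  let ?A = "take (length F div 2) F"
  have F: "F = ?A @ mirror ?A" using symmetric_forest_decomp(1) assms by blast
  have "forest_size F = 2 * forest_size ?A"
    by (subst F) (simp only: forest_size_simps forest_size_mirror)
  moreover have "forest_path F = forest_path ?A @ forest_path (mirror ?A)"
    by (subst F) (simp only: forest_path_simps)
  ultimately show ?thesis
    using assms(2) by (simp add: half_path_def left_part.simps[of F])
qed

lemma half_path_odd:
  assumes "symmetric_forest F" "odd (length F)"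
  defines "A \<equiv> take (length F div 2) F" and "H \<equiv> subtrees (F ! (length F div 2))"
  shows "half_path F = forest_path A @ Up # half_path H"
proof -
  have F: "F = A @ Node H # mirror A"
    using symmetric_forest_decomp(2)[OF assms(1,2)] by (simp add: A_def H_def)
  have "forest_size F = 2 * forest_size A + Suc (forest_size H)"
    by (subst F) simp
  moreover have "forest_path F = forest_path A @ Up # forest_path H @ Down # forest_path (mirror A)"
    by (subst F) (simp only: forest_path_simps)
  ultimately show ?thesis by (simp add: half_path_def)
qed

lemma qint_1: "qint 1 n = of_nat n"
  by (simp add: qint_def)

text \<open>
  The form that the nesting identity takes for a center vertex at \<open>q = 1\<close>: its down step is missing
  on the left-hand side. A down step doubles the constant sequence, whence the factor 2.
\<close>
lemma nest_op_const:
  "2 * real (Suc n) * (\<Sum>r\<le>i. up_op 1 ((leaf_op 1 ^^ n) (\<lambda>_. 1)) (i - r)) =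
     (leaf_op 1 ^^ Suc n) (\<lambda>_. 1) i"
proof -
  have d: "down_op 1 (\<lambda>_. 1) = (\<lambda>_. 2 * (1 :: real))"
    by (simp add: fun_eq_iff down_op_def)
  have e: "(leaf_op 1 ^^ n) (\<lambda>_. 2 * (1 :: real)) = (\<lambda>i. 2 * (leaf_op 1 ^^ n) (\<lambda>_. 1) i)"
    by (rule leaf_pow_scale)
  show ?thesis
    using nest_op_leaf_pow[where q = "1 :: real" and n = n and f = "\<lambda>_. 1" and i = i]
    unfolding nest_op_def d e up_op_scale
    by (simp add: qint_1 algebra_simps flip: sum_distrib_left)
qed

text \<open>
  Induction along the center line: a vertex on it is an unmatched up step of the half path.
\<close>
lemma code_gf_half_path:
  assumes "symmetric_forest F"
  shows "(\<Prod>h\<leftarrow>hooks (left_part F). real h) * 2 ^ center_vertices F *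
           code_gf 1 (\<lambda>_. 1) (half_path F) st (top_cut st + i) =
         (leaf_op 1 ^^ forest_size (left_part F)) (\<lambda>_. 1) i"
  using assms
proof (induction F arbitrary: st i rule: left_part.induct)
  case (1 F)
  let ?A = "take (length F div 2) F" and ?H = "subtrees (F ! (length F div 2))"
  have hooks: "(\<Prod>h\<leftarrow>hooks L. real h) * forest_op 1 L f i = (leaf_op 1 ^^ forest_size L) f i"
    for L f i using hooks_forest_op[of 1 L f i] by (simp add: qint_1[abs_def])
  have gf: "code_gf 1 f (forest_path L @ w) st (top_cut st + i)
      = forest_op 1 L (\<lambda>j. code_gf 1 f w st (top_cut st + j)) i" for L w i and f :: "nat \<Rightarrow> real"
    by (simp add: code_gf_forest)
  show ?case
  proof (cases "even (length F)")
    case True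
    then show ?thesis
      using half_path_even[OF 1(2) True] hooks[of "left_part F" "\<lambda>_. 1" i]
        gf[of "\<lambda>_. 1" "left_part F" "[]" i]
      by (simp add: center_vertices.simps[of F])
  next
    case False
    let ?b = "top_cut st"
    let ?n = "forest_size (left_part ?H)" and ?k = "center_vertices ?H"
    let ?a = "\<Prod>h\<leftarrow>hooks ?A. real h" and ?c = "\<Prod>h\<leftarrow>hooks (left_part ?H). real h"
    define g :: "nat \<Rightarrow> real" where
      "g = (\<lambda>j. code_gf 1 (\<lambda>_. 1) (Up # half_path ?H) st (?b + j))"
    have L: "left_part F = ?A @ [Node (left_part ?H)]" and k: "center_vertices F = Suc ?k"
      using False by (simp_all add: left_part.simps[of F] center_vertices.simps[of F])
    have IH: "?c * 2 ^ ?k * code_gf 1 (\<lambda>_. 1) (half_path ?H) ((?b + r) # st) (?b + r + j)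
        = (leaf_op 1 ^^ ?n) (\<lambda>_. 1) j" for r j
      using 1(1)[OF False symmetric_forest_decomp(3)[OF 1(2) False], of "(?b + r) # st" j] by simp
    have IH': "(\<lambda>j. ?c * 2 ^ ?k * code_gf 1 (\<lambda>_. 1) (half_path ?H) ((?b + r) # st) (?b + r + j))
        = (leaf_op 1 ^^ ?n) (\<lambda>_. 1)" for r
      by (rule ext) (rule IH)
    have "?c * 2 ^ ?k * g j = (\<Sum>r\<le>j. up_op 1 ((leaf_op 1 ^^ ?n) (\<lambda>_. 1)) (j - r))" for j
      by (simp only: g_def code_gf_Up sum_distrib_left fun_cong[OF up_op_scale, symmetric] IH')
    then have "2 * real (Suc ?n) * (?c * 2 ^ ?k * g j) = (leaf_op 1 ^^ Suc ?n) (\<lambda>_. 1) j" for j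
      by (simp only: nest_op_const)
    then have g: "(real (Suc ?n) * ?c * 2 ^ Suc ?k) * g j = (leaf_op 1 ^^ Suc ?n) (\<lambda>_. 1) j" for j
      by (simp only: power_Suc mult_ac)
    then have g_fun: "(\<lambda>j. (real (Suc ?n) * ?c * 2 ^ Suc ?k) * g j) = (leaf_op 1 ^^ Suc ?n) (\<lambda>_. 1)"
      by (rule ext)
    have "(\<Prod>h\<leftarrow>hooks (left_part F). real h) * 2 ^ center_vertices F *
             code_gf 1 (\<lambda>_. 1) (half_path F) st (?b + i)
          = (real (Suc ?n) * ?c * 2 ^ Suc ?k) * (?a * forest_op 1 ?A g i)"
      unfolding half_path_odd[OF 1(2) False] gf L k g_def by simp
    also have "\<dots> = (real (Suc ?n) * ?c * 2 ^ Suc ?k) * (leaf_op 1 ^^ forest_size ?A) g i"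
      by (simp only: hooks)
    also have "\<dots> = (leaf_op 1 ^^ forest_size ?A) ((leaf_op 1 ^^ Suc ?n) (\<lambda>_. 1)) i"
      by (simp only: g_fun[symmetric] leaf_pow_scale)
    also have "\<dots> = (leaf_op 1 ^^ forest_size (left_part F)) (\<lambda>_. 1) i"
      by (simp only: L forest_size_simps funpow_add comp_apply add_0_right)
    finally show ?thesis .
  qed
qed

lemma qfact_1: "qfact 1 n = (fact n :: real)"
  by (induction n) (simp_all add: qfact_def qint_1 algebra_simps)

lemma code_gf_half_path_count:
  assumes "symmetric_forest F"
  shows "(\<Prod>h\<leftarrow>hooks (left_part F). real h) * 2 ^ center_vertices F *
           code_gf 1 (\<lambda>_. 1) (half_path F) [] 0 =
         2 ^ forest_size (left_part F) * fact (forest_size (left_part F))"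
  using code_gf_half_path[OF assms, of "[]" 0]
    leaf_pow_geometric[where n = "forest_size (left_part F)" and q = "1 :: real" and x = 1]
  by (simp add: qfact_1)

lemma code_gf_half_path_weighted:
  assumes "symmetric_forest F" "center_vertices F = 0"
  shows "(\<Prod>h\<leftarrow>hooks (left_part F). qint q h) *
           code_gf q (\<lambda>j. (t * q) ^ j) (half_path F) [] 0 =
         qfact q (forest_size (left_part F)) * (\<Prod>i = 1..forest_size (left_part F). 1 + t * q ^ i)"
proof -
  let ?n = "forest_size (left_part F)"
  have "even (length F)"
    using assms(2) center_vertices.simps[of F] by (metis Zero_not_Suc)
  then have "code_gf q (\<lambda>j. (t * q) ^ j) (half_path F) [] 0
      = forest_op q (left_part F) (\<lambda>j. (t * q) ^ j) 0"
    using code_gf_forest[where F = "left_part F" and st = "[]" and i = 0 and w = "[]"]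
      half_path_even[OF assms(1)] by simp
  moreover have "(\<Prod>i<?n. 1 + q ^ i * (t * q)) = (\<Prod>i = 1..?n. 1 + t * q ^ i)"
    by (rule prod.reindex_bij_witness[of _ "\<lambda>i. i - 1" Suc]) (auto simp: mult_ac)
  ultimately show ?thesis
    by (simp add: hooks_forest_op leaf_pow_geometric)
qed

section \<open>Heights of lattice paths\<close>

definition ups :: "step list \<Rightarrow> nat \<Rightarrow> int" where
  "ups w m = int (count_list (take m w) Up)"

lemma count_Up_Down: "count_list w Up + count_list w Down = length w"
proof (induction w)
  case (Cons s w)
  then show ?case by (cases s) auto
qed simp

lemma ups_0 [simp]: "ups w 0 = 0"
  by (simp add: ups_def)

lemma ups_Suc: "m < length w \<Longrightarrow> ups w (Suc m) = ups w m + (if w ! m = Up then 1 else 0)"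
  by (simp add: ups_def take_Suc_conv_app_nth)

lemma ups_append:
  "ups (u @ v) m = (if m \<le> length u then ups u m else ups u (length u) + ups v (m - length u))"
  by (simp add: ups_def)

lemma ups_add: "ups w (m + k) = ups w m + ups (drop m w) k"
  by (simp add: ups_def take_add)

lemma ups_take: "k \<le> n \<Longrightarrow> ups (take n w) k = ups w k"
  by (simp add: ups_def min_def)

lemma point_at_ups: "m \<le> length w \<Longrightarrow> point_at w m = (int m - ups w m, ups w m)"
  using count_Up_Down[of "take m w"] by (simp add: point_at_def ups_def)

lemma ups_mono: "m \<le> n \<Longrightarrow> ups w m \<le> ups w n"
  using ups_add[of w m "n - m"] by (simp add: ups_def)

lemma downs_mono:
  assumes "m \<le> n" "n \<le> length w"
  shows "int m - ups w m \<le> int n - ups w n"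
proof -
  have "count_list (take (n - m) (drop m w)) Up \<le> n - m"
    using count_Up_Down[of "take (n - m) (drop m w)"] assms by simp
  then show ?thesis
    using assms ups_add[of w m "n - m"] by (simp add: ups_def)
qed

text \<open>
  A cell is compared with the point of the path on its own antidiagonal, because coordinates are monotone
  along the path.
\<close>
lemma below_path_iff:
  assumes "m \<le> length w"
  shows "below_path w (int m - 1 - j, j) \<longleftrightarrow> j < ups w m"
proof
  assume "below_path w (int m - 1 - j, j)"
  then obtain s where s: "s \<le> length w" "int s - ups w s \<le> int m - 1 - j" "j + 1 \<le> ups w s"
    by (auto simp: below_path_def points_def point_at_ups)
  show "j < ups w m"
    using s ups_mono[of s m w] downs_mono[of m s w] by (cases "s \<le> m") auto
next
  assume "j < ups w m"
  then show "below_path w (int m - 1 - j, j)"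
    using assms by (auto simp: below_path_def points_def point_at_ups intro!: bexI[of _ m])
qed

lemma above_path_iff:
  assumes "m \<le> length w"
  shows "above_path w (int m - 1 - j, j) \<longleftrightarrow> ups w m \<le> j"
proof
  assume "above_path w (int m - 1 - j, j)"
  then obtain s where s: "s \<le> length w" "int m - j \<le> int s - ups w s" "ups w s \<le> j"
    by (auto simp: above_path_def points_def point_at_ups)
  show "ups w m \<le> j"
    using s ups_mono[of m s w] downs_mono[of s m w] assms by (cases "s \<le> m") auto
next
  assume "ups w m \<le> j"
  then show "above_path w (int m - 1 - j, j)"
    using assms by (auto simp: above_path_def points_def point_at_ups intro!: bexI[of _ m])
qed

lemma dyck_path_iff:
  "dyck_path N w \<longleftrightarrow> length w = 2 * N \<and> ups w (2 * N) = int N \<and> (\<forall>m\<le>2 * N. int m \<le> 2 * ups w m)"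
proof (cases "length w = 2 * N")
  case True
  have point: "(case point_at w m of (x, y) \<Rightarrow> x \<le> y) \<longleftrightarrow> int m \<le> 2 * ups w m"
    if "m \<in> {0..2 * N}" for m
    using that True by (simp add: point_at_ups)
  have "(\<forall>(x, y)\<in>points w. x \<le> y) \<longleftrightarrow>
      (\<forall>m\<in>{0..2 * N}. case point_at w m of (x, y) \<Rightarrow> x \<le> y)"
    by (simp only: points_def True ball_simps)
  also have "\<dots> \<longleftrightarrow> (\<forall>m\<in>{0..2 * N}. int m \<le> 2 * ups w m)"
    by (rule ball_cong[OF refl]) (rule point)
  also have "\<dots> \<longleftrightarrow> (\<forall>m\<le>2 * N. int m \<le> 2 * ups w m)"
    by auto
  finally have "(\<forall>(x, y)\<in>points w. x \<le> y) \<longleftrightarrow> (\<forall>m\<le>2 * N. int m \<le> 2 * ups w m)" .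
  moreover have "point_at w (2 * N) = (int N, int N) \<longleftrightarrow> ups w (2 * N) = int N"
    using True point_at_ups[of "2 * N" w] by auto
  ultimately show ?thesis
    using True by (simp add: dyck_path_def)
qed (simp add: dyck_path_def)

lemma symmetric_path_iff:
  assumes "length w = 2 * N"
  shows "symmetric_path N w \<longleftrightarrow> (\<forall>m\<le>2 * N. ups w (2 * N - m) = ups w m + int N - int m)"
proof
  assume sym: "symmetric_path N w"
  show "\<forall>m\<le>2 * N. ups w (2 * N - m) = ups w m + int N - int m"
  proof (intro allI impI)
    fix m assume m: "m \<le> 2 * N"
    have "reflect_point N (point_at w m) \<in> points w"
      using sym m assms by (auto simp: symmetric_path_def points_def)
    then obtain s where s: "s \<le> 2 * N" "int N - ups w m = int s - ups w s"
      "int N - (int m - ups w m) = ups w s"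
      using m assms by (auto simp: points_def point_at_ups reflect_point_def)
    then have "s = 2 * N - m" using m by linarith
    then show "ups w (2 * N - m) = ups w m + int N - int m" using s by simp
  qed
next
  assume *: "\<forall>m\<le>2 * N. ups w (2 * N - m) = ups w m + int N - int m"
  have r: "reflect_point N (point_at w m) = point_at w (2 * N - m)" if "m \<le> 2 * N" for m
    using that * assms by (simp add: point_at_ups reflect_point_def of_nat_diff)
  have rev: "(\<lambda>m. 2 * N - m) ` {0..2 * N} = {0..2 * N}"
  proof (intro equalityI subsetI)
    fix x assume "x \<in> {0..2 * N}"
    then show "x \<in> (\<lambda>m. 2 * N - m) ` {0..2 * N}" by (intro image_eqI[of _ _ "2 * N - x"]) auto
  qed auto
  have "points w = point_at w ` (\<lambda>m. 2 * N - m) ` {0..2 * N}"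
    by (simp only: points_def assms rev)
  also have "\<dots> = (\<lambda>m. point_at w (2 * N - m)) ` {0..2 * N}"
    by (rule image_image)
  also have "\<dots> = reflect_point N ` points w"
    unfolding points_def image_image assms by (intro image_cong) (auto simp: r)
  finally show "symmetric_path N w" by (simp add: symmetric_path_def)
qed

lemma forest_path_height: "m \<le> length (forest_path F) \<Longrightarrow> int m \<le> 2 * ups (forest_path F) m"
  and forest_path_ups: "ups (forest_path F) (2 * forest_size F) = int (forest_size F)"
proof -
  have count: "count_list (forest_path F) Up = forest_size F" for F
    by (induction F rule: forest_induct) auto
  then show "ups (forest_path F) (2 * forest_size F) = int (forest_size F)"
    by (simp add: ups_def)
  show "int m \<le> 2 * ups (forest_path F) m" if "m \<le> length (forest_path F)"
    using that
  proof (induction F arbitrary: m rule: forest_induct)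
    case (Node G F)
    let ?g = "forest_path G" and ?f = "forest_path F"
    have path: "forest_path (Node G # F) = ((Up # ?g) @ [Down]) @ ?f" by simp
    have up: "ups (Up # ?g) k = (if k = 0 then 0 else 1 + ups ?g (k - 1))" for k
      by (cases k) (auto simp: ups_def)
    have g: "ups ?g (2 * forest_size G) = int (forest_size G)"
      by (simp add: ups_def count)
    consider "m = 0" | "0 < m" "m \<le> Suc (length ?g)" | "m = Suc (Suc (length ?g))"
      | "Suc (Suc (length ?g)) < m" by linarith
    then show ?case
    proof cases
      case 2
      then have "m - 1 \<le> length ?g" "int (m - 1) = int m - 1" by auto
      then show ?thesis using 2 Node(1)[of "m - 1"]
        unfolding path by (simp add: ups_append up del: append_Cons)
    next
      case 3
      then show ?thesis
        unfolding path by (simp add: ups_append up g ups_def[of "[Down]"] del: append_Cons)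
    next
      case 4
      then have "m - Suc (Suc (length ?g)) \<le> length ?f" "\<not> m - Suc (length ?g) \<le> 1"
        using Node(3) by auto
      then show ?thesis using 4 Node(2)[of "m - Suc (Suc (length ?g))"]
        unfolding path by (simp add: ups_append up g ups_def[of "[Down]"] del: append_Cons)
    qed simp
  qed simp
qed

primrec flip :: "step \<Rightarrow> step" where
  "flip Up = Down"
| "flip Down = Up"

lemma forest_path_mirror: "forest_path (mirror F) = rev (map flip (forest_path F))"
  by (induction F rule: forest_induct) simp_all

lemma symmetric_forest_path_ups:
  assumes "symmetric_forest F" "m \<le> 2 * forest_size F"
  shows "ups (forest_path F) (2 * forest_size F - m) = ups (forest_path F) m + int (forest_size F) - int m"
proof -
  let ?w = "forest_path F" and ?N = "forest_size F"
  have w: "rev (map flip ?w) = ?w"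
    using assms(1) forest_path_mirror[of F] by (simp add: symmetric_forest_def)
  have flip: "count_list (map flip v) Up = count_list v Down" for v
  proof (induction v)
    case (Cons s v)
    then show ?case by (cases s) auto
  qed simp
  have "int ?N = ups ?w (2 * ?N - m + m)"
    using assms(2) forest_path_ups[of F] by simp
  also have "\<dots> = ups ?w (2 * ?N - m) + ups (drop (2 * ?N - m) ?w) m"
    by (rule ups_add)
  also have "drop (2 * ?N - m) ?w = rev (map flip (take m ?w))"
    using assms(2) by (subst w[symmetric]) (simp add: drop_rev take_map)
  also have "ups (rev (map flip (take m ?w))) m = int (count_list (take m ?w) Down)"
    using assms(2) by (simp add: ups_def flip)
  also have "\<dots> = int m - ups ?w m"
    using count_Up_Down[of "take m ?w"] assms(2) by (simp add: ups_def)
  finally show ?thesis by simp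
qed

section \<open>Coordinates relative to a symmetric Dyck path\<close>

text \<open>
  What is needed of the path of a symmetric forest, in terms of the numbers of up steps in its
  prefixes.
\<close>
locale symmetric_dyck_path =
  fixes N :: nat and lam :: "step list"
  assumes length_lam: "length lam = 2 * N"
    and height_nonneg: "m \<le> 2 * N \<Longrightarrow> int m \<le> 2 * ups lam m"
    and ups_reflect: "m \<le> 2 * N \<Longrightarrow> ups lam (2 * N - m) = ups lam m + int N - int m"
begin

definition height :: "nat \<Rightarrow> int" where
  "height m = 2 * ups lam m - int m"

text \<open>
  A cell is addressed by the index \<open>m\<close> of the point of \<open>\<lambda>\<close> on the diagonal \<open>x + y = m\<close> through
  its center, and by its layer \<open>l\<close>: layer 0 lies on \<open>\<lambda>\<close>, and negative layers lie below it. Both the shift by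
  \<open>(1, -1)\<close> and the reflection are simple in these coordinates.
\<close>
definition cell_at :: "nat \<Rightarrow> int \<Rightarrow> cell" where
  "cell_at m l = (int m - 1 - (ups lam m + l), ups lam m + l)"

definition strip :: "nat \<Rightarrow> nat \<Rightarrow> nat \<Rightarrow> cell set" where
  "strip a b l = (\<lambda>m. cell_at m (int l)) ` {a..b}"

text \<open>
  The pieces of \<open>\<lambda>\<close> that are translates of Dyck paths.
\<close>
definition dyck_interval :: "nat \<Rightarrow> nat \<Rightarrow> bool" where
  "dyck_interval a b \<longleftrightarrow>
     a \<le> b \<and> b \<le> 2 * N \<and> height a = height b \<and> (\<forall>m\<in>{a..b}. height a \<le> height m)"

text \<open>
  The numbers of layers between \<open>\<lambda>\<close> and a symmetric upper Dyck path: shifting the point \<open>m\<close> of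
  \<open>\<lambda>\<close> by \<open>h m\<close> times \<open>(-1, 1)\<close> must again give a lattice path.
\<close>
definition profile :: "(nat \<Rightarrow> nat) \<Rightarrow> bool" where
  "profile h \<longleftrightarrow> h 0 = 0 \<and> (\<forall>m\<le>2 * N. h (2 * N - m) = h m) \<and>
     (\<forall>m<2 * N. if lam ! m = Up then h m \<in> {h (Suc m), Suc (h (Suc m))}
                else h (Suc m) \<in> {h m, Suc (h m)})"

text \<open>
  Symmetric Dyck tilings in the coordinates given by layers; the fourth conjunct is the condition on translates of
  tiles.
\<close>
definition flat_tiling :: "(nat \<Rightarrow> nat) \<Rightarrow> cell set set \<Rightarrow> bool" where
  "flat_tiling h D \<longleftrightarrow>
     (\<forall>\<eta>\<in>D. \<exists>a b l. \<eta> = strip a b l \<and> dyck_interval a b) \<and>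
     (\<forall>\<eta>\<in>D. \<forall>\<eta>'\<in>D. \<eta> \<noteq> \<eta>' \<longrightarrow> \<eta> \<inter> \<eta>' = {}) \<and>
     \<Union>D = {cell_at m (int l) | m l. m \<le> 2 * N \<and> l < h m} \<and>
     (\<forall>a b l. a \<le> b \<longrightarrow> strip a b (Suc l) \<in> D \<longrightarrow>
        (\<exists>a' b'. a' \<le> a \<and> b \<le> b' \<and> strip a' b' l \<in> D)) \<and>
     (\<forall>a b l. a \<le> b \<longrightarrow> b \<le> 2 * N \<longrightarrow> strip a b l \<in> D \<longrightarrow> strip (2 * N - b) (2 * N - a) l \<in> D)"

lemma cell_at_eq_iff [simp]: "cell_at m l = cell_at m' l' \<longleftrightarrow> m = m' \<and> l = l'"
proof
  assume e: "cell_at m l = cell_at m' l'"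
  then have "m = m'" by (simp add: cell_at_def)
  with e show "m = m' \<and> l = l'" by (simp add: cell_at_def)
qed simp

lemma in_strip_iff: "cell_at m (int l) \<in> strip a b l' \<longleftrightarrow> l = l' \<and> a \<le> m \<and> m \<le> b"
  by (auto simp: strip_def)

lemma strip_eq_iff: "a \<le> b \<Longrightarrow> strip a b l = strip a' b' l' \<longleftrightarrow> a = a' \<and> b = b' \<and> l = l'"
proof
  assume "a \<le> b" and e: "strip a b l = strip a' b' l'"
  then have *: "cell_at m (int k) \<in> strip a b l \<longleftrightarrow> cell_at m (int k) \<in> strip a' b' l'" for m k
    by simp
  have "l = l'" "a' \<le> a" "b \<le> b'"
    using *[of a l] *[of b l] \<open>a \<le> b\<close> by (simp_all add: in_strip_iff)
  then show "a = a' \<and> b = b' \<and> l = l'"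
    using *[of a' l] *[of b' l] \<open>a \<le> b\<close> by (simp add: in_strip_iff)
qed simp

lemma reflect_cell_at: "m \<le> 2 * N \<Longrightarrow> reflect_cell N (cell_at m l) = cell_at (2 * N - m) l"
  by (simp add: reflect_cell_def cell_at_def ups_reflect of_nat_diff)

lemma reflect_strip:
  assumes "a \<le> b" "b \<le> 2 * N"
  shows "reflect_cell N ` strip a b l = strip (2 * N - b) (2 * N - a) l"
proof -
  have rev: "(\<lambda>m. 2 * N - m) ` {a..b} = {2 * N - b..2 * N - a}"
  proof (intro equalityI subsetI)
    fix x assume "x \<in> {2 * N - b..2 * N - a}"
    then show "x \<in> (\<lambda>m. 2 * N - m) ` {a..b}"
      using assms by (intro image_eqI[of _ _ "2 * N - x"]) auto
  qed (use assms in auto)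
  have "reflect_cell N ` strip a b l = (\<lambda>m. cell_at (2 * N - m) (int l)) ` {a..b}"
    unfolding strip_def image_image using assms by (intro image_cong) (auto simp: reflect_cell_at)
  also have "\<dots> = (\<lambda>m. cell_at m (int l)) ` (\<lambda>m. 2 * N - m) ` {a..b}"
    by (rule image_image[symmetric])
  finally show ?thesis by (simp only: rev strip_def)
qed

lemma height_reflect: "m \<le> 2 * N \<Longrightarrow> height (2 * N - m) = height m"
  by (simp add: height_def ups_reflect of_nat_diff)

lemma height_Suc: "m < 2 * N \<Longrightarrow> height (Suc m) = height m + (if lam ! m = Up then 1 else - 1)"
  by (simp add: height_def ups_Suc length_lam)

lemma step_reflect:
  assumes "m < 2 * N"
  shows "lam ! (2 * N - Suc m) = Up \<longleftrightarrow> lam ! m \<noteq> Up"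
proof -
  have "height (Suc (2 * N - Suc m)) = height m" "height (2 * N - Suc m) = height (Suc m)"
    using assms height_reflect[of m] height_reflect[of "Suc m"] by (simp_all add: Suc_diff_Suc)
  then show ?thesis
    using height_Suc[of "2 * N - Suc m"] height_Suc[of m] assms by (auto split: if_splits)
qed

text \<open>
  Over each point of \<open>\<lambda>\<close> the two paths bound the layers separately. Cells with \<open>i + j + 1\<close> outside the range
  of \<open>m\<close> do not lie between the paths, since both paths stay within the square of side \<open>N\<close>.
\<close>
lemma region_eq:
  assumes "dyck_path N mu" "weakly_above mu lam"
  shows "region lam mu =
    {cell_at m (int l) | m l. m \<le> 2 * N \<and> l < nat (ups mu m - ups lam m)}" (is "_ = ?R")
proof -
  have len: "length mu = 2 * N" and top: "ups mu (2 * N) = int N"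
    using assms(1) by (auto simp: dyck_path_iff)
  have lamN: "ups lam (2 * N) = int N" using ups_reflect[of 0] by simp
  have iff: "c \<in> region lam mu \<longleftrightarrow> 0 \<le> l \<and> l < ups mu m - ups lam m"
    if "c = cell_at m l" "m \<le> 2 * N" for c m l
    using that above_path_iff[of m lam "ups lam m + l"] below_path_iff[of m mu "ups lam m + l"]
    by (auto simp: region_def cell_at_def len length_lam)
  have "\<exists>m l. m \<le> 2 * N \<and> c = cell_at m l" if "c \<in> region lam mu" for c
  proof -
    obtain i j where c: "c = (i, j)" by (cases c)
    from that obtain s t where st: "s \<le> 2 * N" "t \<le> 2 * N"
      "i + 1 \<le> int s - ups lam s" "ups lam s \<le> j" "int t - ups mu t \<le> i" "j + 1 \<le> ups mu t"
      by (auto simp: region_def c above_path_def below_path_def points_def point_at_ups length_lam len)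
    have "0 \<le> ups lam s" "int s - ups lam s \<le> int N" "0 \<le> int t - ups mu t" "ups mu t \<le> int N"
      using ups_mono[of 0 s lam] downs_mono[of s "2 * N" lam] downs_mono[of 0 t mu]
        ups_mono[of t "2 * N" mu] st len length_lam lamN top by auto
    then have "0 \<le> i + j + 1" "i + j + 1 \<le> 2 * int N" using st by linarith+
    then have "c = cell_at (nat (i + j + 1)) (j - ups lam (nat (i + j + 1)))"
      "nat (i + j + 1) \<le> 2 * N"
      by (auto simp: c cell_at_def)
    then show ?thesis by blast
  qed
  then show ?thesis
  proof (intro equalityI subsetI)
    fix c assume c: "c \<in> region lam mu"
    then obtain m l where "m \<le> 2 * N" "c = cell_at m l"
      using \<open>\<And>c. c \<in> region lam mu \<Longrightarrow> _\<close> by blast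
    moreover from this have "0 \<le> l" "l < ups mu m - ups lam m" using iff c by auto
    ultimately show "c \<in> ?R" by (intro CollectI exI[of _ m] exI[of _ "nat l"]) auto
  next
    fix c assume "c \<in> ?R"
    then obtain m l where "m \<le> 2 * N" "l < nat (ups mu m - ups lam m)" "c = cell_at m (int l)"
      by blast
    then show "c \<in> region lam mu" using iff[of c m "int l"] by auto
  qed
qed

lemma dyck_tile_strip:
  assumes "dyck_interval a b"
  shows "dyck_tile (strip a b l)"
proof -
  let ?k = "nat (ups lam b - ups lam a)"
  let ?w = "take (b - a) (drop a lam)"
  have ab: "a \<le> b" "b \<le> 2 * N" "height a = height b" "\<And>m. a \<le> m \<Longrightarrow> m \<le> b \<Longrightarrow> height a \<le> height m"
    using assms by (auto simp: dyck_interval_def)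
  have len: "length ?w = b - a" using ab by (simp add: length_lam)
  have k: "b - a = 2 * ?k" using ab ups_mono[of a b lam] by (simp add: height_def)
  have u: "ups ?w t = ups lam (a + t) - ups lam a" if "t \<le> b - a" for t
    using that ups_add[of lam a t] by (simp add: ups_take)
  have "dyck_path ?k ?w"
    unfolding dyck_path_iff len k[symmetric]
  proof (intro conjI allI impI)
    show "ups ?w (b - a) = int ?k" using u[of "b - a"] ab ups_mono[of a b lam] by simp
    fix t assume "t \<le> b - a"
    then have "height a \<le> height (a + t)" using ab(1) by (intro ab(4)) auto
    then show "int t \<le> 2 * ups ?w t" using u[OF \<open>t \<le> b - a\<close>] by (simp add: height_def)
  qed simp
  moreover have "strip a b l = (\<lambda>(x, y). (int a - 1 - (ups lam a + int l) + x, ups lam a + int l + y)) ` points ?w"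
  proof -
    have "{a..b} = (\<lambda>t. a + t) ` {0..b - a}"
    proof (intro equalityI subsetI)
      fix x assume "x \<in> {a..b}"
      then show "x \<in> (\<lambda>t. a + t) ` {0..b - a}" by (intro image_eqI[of _ _ "x - a"]) auto
    qed (use ab(1) in auto)
    then have "strip a b l = (\<lambda>t. cell_at (a + t) (int l)) ` {0..b - a}"
      by (simp only: strip_def image_image)
    also have "\<dots> = (\<lambda>t. (\<lambda>(x, y). (int a - 1 - (ups lam a + int l) + x, ups lam a + int l + y))
        (point_at ?w t)) ` {0..b - a}"
    proof (intro image_cong)
      fix t assume t: "t \<in> {0..b - a}"
      then have "point_at ?w t = (int t - ups ?w t, ups ?w t)" using len by (intro point_at_ups) simp
      then show "cell_at (a + t) (int l) =
          (\<lambda>(x, y). (int a - 1 - (ups lam a + int l) + x, ups lam a + int l + y)) (point_at ?w t)"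
        using u[of t] t by (simp add: cell_at_def)
    qed simp
    finally show ?thesis unfolding points_def len image_image .
  qed
  ultimately have "dyck_path ?k ?w \<and> strip a b l =
      (\<lambda>(x, y). (int a - 1 - (ups lam a + int l) + x, ups lam a + int l + y)) ` points ?w"
    by (rule conjI)
  then show ?thesis
    unfolding dyck_tile_def
    apply -
    apply (rule exI[of _ ?k])
    apply (rule exI[of _ ?w])
    apply (rule exI[of _ "int a - 1 - (ups lam a + int l)"])
    apply (rule exI[of _ "ups lam a + int l"])
    apply assumption
    done
qed

lemma shift_cell_at: "(\<lambda>(i, j). (i + 1, j - 1)) (cell_at m l) = cell_at m (l - 1)"
  by (simp add: cell_at_def)

lemma shift_strip_Suc: "shift (strip a b (Suc l)) = strip a b l"
  unfolding shift_def strip_def image_image by (simp add: shift_cell_at)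

lemma below_lam_iff: "m \<le> 2 * N \<Longrightarrow> below_path lam (cell_at m l) \<longleftrightarrow> l < 0"
  using below_path_iff[of m lam "ups lam m + l"] by (simp add: cell_at_def length_lam)

end

section \<open>Tiles are translates of pieces of the lower path\<close>

lemma dyck_tilingD:
  assumes "dyck_tiling lam mu D"
  shows dyck_tiling_tile: "\<And>\<eta>. \<eta> \<in> D \<Longrightarrow> dyck_tile \<eta>"
    and dyck_tiling_disjoint: "\<And>\<eta> \<eta>'. \<eta> \<in> D \<Longrightarrow> \<eta>' \<in> D \<Longrightarrow> \<eta> \<noteq> \<eta>' \<Longrightarrow> \<eta> \<inter> \<eta>' = {}"
    and dyck_tiling_union: "\<Union>D = region lam mu"
    and dyck_tiling_cover: "\<And>\<eta>. \<eta> \<in> D \<Longrightarrow>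
      (\<forall>c\<in>shift \<eta>. below_path lam c) \<or> (\<exists>\<eta>'\<in>D - {\<eta>}. shift \<eta> \<subseteq> \<eta>')"
  using assms unfolding dyck_tiling_def by (elim conjE; simp)+

context symmetric_dyck_path
begin

lemma flat_tilingD:
  assumes "flat_tiling h D"
  shows flat_tiling_strip: "\<And>\<eta>. \<eta> \<in> D \<Longrightarrow> \<exists>a b l. \<eta> = strip a b l \<and> dyck_interval a b"
    and flat_tiling_disjoint: "\<And>\<eta> \<eta>'. \<eta> \<in> D \<Longrightarrow> \<eta>' \<in> D \<Longrightarrow> \<eta> \<noteq> \<eta>' \<Longrightarrow> \<eta> \<inter> \<eta>' = {}"
    and flat_tiling_union: "\<Union>D = {cell_at m (int l) | m l. m \<le> 2 * N \<and> l < h m}"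
    and flat_tiling_cover: "\<And>a b l. a \<le> b \<Longrightarrow> strip a b (Suc l) \<in> D \<Longrightarrow>
        \<exists>a' b'. a' \<le> a \<and> b \<le> b' \<and> strip a' b' l \<in> D"
    and flat_tiling_reflect: "\<And>a b l. a \<le> b \<Longrightarrow> b \<le> 2 * N \<Longrightarrow> strip a b l \<in> D \<Longrightarrow>
        strip (2 * N - b) (2 * N - a) l \<in> D"
  using assms unfolding flat_tiling_def by (elim conjE; simp)+

lemma profile_of_path:
  assumes "dyck_path N mu" "symmetric_path N mu" "weakly_above mu lam"
  shows "profile (\<lambda>m. nat (ups mu m - ups lam m))"
proof -
  have len: "length mu = 2 * N" using assms(1) by (simp add: dyck_path_def)
  have sym: "ups mu (2 * N - m) = ups mu m + int N - int m" if "m \<le> 2 * N" for m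
    using assms(2) symmetric_path_iff[OF len] that by simp
  have above: "ups lam m \<le> ups mu m" for m
    using assms(3) by (simp add: weakly_above_def ups_def)
  show ?thesis
    unfolding profile_def
  proof (intro conjI allI impI)
    fix m assume m: "m < 2 * N"
    show "if lam ! m = Up then nat (ups mu m - ups lam m)
            \<in> {nat (ups mu (Suc m) - ups lam (Suc m)), Suc (nat (ups mu (Suc m) - ups lam (Suc m)))}
          else nat (ups mu (Suc m) - ups lam (Suc m))
            \<in> {nat (ups mu m - ups lam m), Suc (nat (ups mu m - ups lam m))}"
      using above[of m] above[of "Suc m"] m
      by (simp add: ups_Suc len length_lam) linarith
  qed (simp_all add: sym ups_reflect)
qed

text \<open>
  The upper path goes up exactly where the number of up steps of \<open>\<lambda>\<close> plus the number of layers
  increases; the conditions on profiles bound this increase by one.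
\<close>
lemma path_of_profile:
  assumes "profile h"
  obtains mu where "dyck_path N mu" "symmetric_path N mu" "weakly_above mu lam"
    "\<And>m. m \<le> 2 * N \<Longrightarrow> ups mu m = ups lam m + int (h m)"
proof
  define f where "f m = ups lam m + int (h m)" for m
  define mu where "mu = map (\<lambda>m. if f m < f (Suc m) then Up else Down) [0..<2 * N]"
  have h: "h 0 = 0" "\<And>m. m \<le> 2 * N \<Longrightarrow> h (2 * N - m) = h m"
    using assms by (auto simp: profile_def)
  have step: "f (Suc m) = f m + (if f m < f (Suc m) then 1 else 0)" if "m < 2 * N" for m
  proof -
    have "if lam ! m = Up then h m \<in> {h (Suc m), Suc (h (Suc m))}
          else h (Suc m) \<in> {h m, Suc (h m)}"
      using assms that by (auto simp: profile_def)
    then show ?thesis using that by (auto simp: f_def ups_Suc length_lam split: if_splits)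
  qed
  have len: "length mu = 2 * N" by (simp add: mu_def)
  show ups: "ups mu m = ups lam m + int (h m)" if "m \<le> 2 * N" for m
    using that
  proof (induction m)
    case (Suc m)
    then have "ups mu (Suc m) = f m + (if f m < f (Suc m) then 1 else 0)"
      by (simp add: ups_Suc len f_def) (simp add: mu_def f_def)
    then show ?case using step[of m] Suc(2) by (simp add: f_def)
  qed (simp add: h)
  have lamN: "ups lam (2 * N) = int N" using ups_reflect[of 0] by simp
  have hN: "h (2 * N) = 0" using h(2)[of 0] h(1) by simp
  show "dyck_path N mu"
    unfolding dyck_path_iff
  proof (intro conjI allI impI)
    fix m assume m: "m \<le> 2 * N"
    show "int m \<le> 2 * ups mu m" using height_nonneg[OF m] ups[OF m] by simp
  qed (simp_all add: len ups lamN hN)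
  show "symmetric_path N mu"
    by (simp add: symmetric_path_iff[OF len] ups ups_reflect h)
  show "weakly_above mu lam"
    unfolding weakly_above_def
  proof
    fix i
    have "take i w = take (min i (2 * N)) w" if "length w = 2 * N" for w :: "step list"
      using that by (cases "i \<le> 2 * N") simp_all
    then show "count_list (take i lam) Up \<le> count_list (take i mu) Up"
      using ups[of "min i (2 * N)"] len length_lam by (simp add: ups_def)
  qed
qed

text \<open>
  All cells of a tile lie in the same layer. A tile with a cell in layer 0 is not followed by another tile
  below that cell, so all of it rests on \<open>\<lambda>\<close>; a tile with a cell in layer \<open>k + 1\<close> is, after the
  translation, part of a tile with a cell in layer \<open>k\<close>.
\<close>
lemma tile_level:
  assumes tiling: "dyck_tiling lam mu D"
    and region: "region lam mu \<subseteq> {cell_at m (int l) | m l. m \<le> 2 * N}"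
    and "\<eta> \<in> D" "cell_at m (int k) \<in> \<eta>" "c \<in> \<eta>"
  shows "\<exists>m'\<le>2 * N. c = cell_at m' (int k)"
proof -
  have cells: "\<exists>m l. m \<le> 2 * N \<and> c = cell_at m (int l)" if "\<eta> \<in> D" "c \<in> \<eta>" for \<eta> c
  proof -
    have "c \<in> region lam mu" using UnionI[OF that] dyck_tiling_union[OF tiling] by simp
    then show ?thesis using region by auto
  qed
  have shift: "cell_at m (l - 1) \<in> shift \<eta>" if "cell_at m l \<in> \<eta>" for m l \<eta>
    unfolding shift_def shift_cell_at[symmetric] using that by (rule imageI)
  have cover: "(\<forall>c\<in>shift \<eta>. below_path lam c) \<or> (\<exists>\<eta>'\<in>D. shift \<eta> \<subseteq> \<eta>')" if "\<eta> \<in> D" for \<eta>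
    using dyck_tiling_cover[OF tiling that] by blast
  show ?thesis using assms(3-5)
  proof (induction k arbitrary: \<eta> m c)
    case 0
    obtain m' l where c: "m' \<le> 2 * N" "c = cell_at m' (int l)" using cells 0 by blast
    have s: "cell_at m (- 1) \<in> shift \<eta>" using shift[OF 0(2)] by simp
    have "cell_at m (- 1) \<notin> \<eta>'" if "\<eta>' \<in> D" for \<eta>'
      using cells[OF that, of "cell_at m (- 1)"] by auto
    then have "\<forall>c\<in>shift \<eta>. below_path lam c"
      using cover[OF 0(1)] s by blast
    moreover have "cell_at m' (int l - 1) \<in> shift \<eta>" using shift 0(3) c(2) by simp
    ultimately have "below_path lam (cell_at m' (int l - 1))" by (rule bspec)
    then show ?case using below_lam_iff c by auto
  next
    case (Suc k)
    obtain m' l where c: "m' \<le> 2 * N" "c = cell_at m' (int l)" using cells Suc by blast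
    have s: "cell_at m (int k) \<in> shift \<eta>" using shift[OF Suc(3)] by simp
    have m: "m \<le> 2 * N" using cells[OF Suc(2,3)] by auto
    have "\<not> below_path lam (cell_at m (int k))" using below_lam_iff[OF m, of "int k"] by simp
    then obtain \<eta>' where \<eta>': "\<eta>' \<in> D" "shift \<eta> \<subseteq> \<eta>'"
      using cover[OF Suc(2)] s by blast
    have "cell_at m' (int l - 1) \<in> shift \<eta>" using shift Suc(4) c(2) by simp
    then obtain m'' where "cell_at m' (int l - 1) = cell_at m'' (int k)"
      using Suc.IH[OF \<eta>'(1) subsetD[OF \<eta>'(2) s]] \<eta>'(2) by blast
    then show ?case using c by (intro exI[of _ m']) simp
  qed
qed

text \<open>
  As a tile stays in one layer, the lattice path of its cell centers is a translate of a piece of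
  \<open>\<lambda>\<close>, and the heights on that piece are those of a Dyck path.
\<close>
lemma flat_tile:
  assumes tiling: "dyck_tiling lam mu D"
    and region: "region lam mu \<subseteq> {cell_at m (int l) | m l. m \<le> 2 * N}"
    and "\<eta> \<in> D"
  shows "\<exists>a b l. \<eta> = strip a b l \<and> dyck_interval a b"
proof -
  have "dyck_tile \<eta>" using dyck_tiling_tile[OF tiling assms(3)] .
  then obtain K w x y where w: "dyck_path K w" and \<eta>: "\<eta> = (\<lambda>(x', y'). (x + x', y + y')) ` points w"
    unfolding dyck_tile_def by blast
  have len: "length w = 2 * K" using w by (simp add: dyck_path_def)
  define cell where "cell t = (x + (int t - ups w t), y + ups w t)" for t
  have \<eta>_cells: "\<eta> = cell ` {0..2 * K}"
    unfolding \<eta> points_def len image_image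
    by (intro image_cong) (simp_all add: cell_def point_at_ups len)
  have "cell 0 \<in> \<eta>" by (simp add: \<eta>_cells)
  then have "cell 0 \<in> region lam mu"
    using UnionI[OF assms(3)] dyck_tiling_union[OF tiling] by simp
  then obtain s k where s: "cell 0 = cell_at s (int k)" using region by blast
  have cell: "s + t \<le> 2 * N \<and> cell t = cell_at (s + t) (int k)" if "t \<le> 2 * K" for t
  proof -
    have "cell t \<in> \<eta>" using that by (simp add: \<eta>_cells)
    then obtain m where m: "m \<le> 2 * N" "cell t = cell_at m (int k)"
      using tile_level[OF tiling region assms(3)] \<open>cell 0 \<in> \<eta>\<close>[unfolded s] by blast
    moreover from this(2) s have "m = s + t" by (simp add: cell_def cell_at_def)
    ultimately show ?thesis by simp
  qed
  have height: "height (s + t) = height s + 2 * ups w t - int t" if "t \<le> 2 * K" for t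
    using cell[OF that] s by (simp add: cell_def cell_at_def height_def)
  have "\<eta> = strip s (s + 2 * K) k"
  proof -
    have "(\<lambda>t. s + t) ` {0..2 * K} = {s..s + 2 * K}"
      using image_add_atLeastAtMost[of s 0 "2 * K"] by simp
    then have "strip s (s + 2 * K) k = (\<lambda>m. cell_at m (int k)) ` (\<lambda>t. s + t) ` {0..2 * K}"
      by (simp only: strip_def)
    also have "\<dots> = cell ` {0..2 * K}"
      unfolding image_image using cell by (intro image_cong) simp_all
    finally show ?thesis by (simp only: \<eta>_cells)
  qed
  moreover have "dyck_interval s (s + 2 * K)"
    unfolding dyck_interval_def
  proof (intro conjI ballI)
    show "s + 2 * K \<le> 2 * N" using cell[of "2 * K"] by simp
    show "height s = height (s + 2 * K)"
      using height[of "2 * K"] w by (simp add: dyck_path_iff)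
    fix m assume "m \<in> {s..s + 2 * K}"
    then obtain t where "m = s + t" "t \<le> 2 * K" by (auto simp: le_iff_add)
    then show "height s \<le> height m"
      using height[of t] w by (auto simp: dyck_path_iff)
  qed simp
  ultimately show ?thesis by blast
qed

lemma flat_tiling_of_Dsym:
  assumes "D \<in> Dsym N lam"
  obtains h where "profile h" "flat_tiling h D"
proof -
  obtain mu where mu: "dyck_path N mu" "symmetric_path N mu" "weakly_above mu lam"
    and tiling: "dyck_tiling lam mu D" and sym: "symmetric_tiling N D"
    using assms by (auto simp: Dsym_def)
  let ?h = "\<lambda>m. nat (ups mu m - ups lam m)"
  have region: "region lam mu \<subseteq> {cell_at m (int l) | m l. m \<le> 2 * N}"
    unfolding region_eq[OF mu(1,3)] by blast
  have union: "\<Union>D = {cell_at m (int l) | m l. m \<le> 2 * N \<and> l < ?h m}"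
    using dyck_tiling_union[OF tiling] region_eq[OF mu(1,3)] by simp
  have flat: "\<exists>a b l. \<eta> = strip a b l \<and> dyck_interval a b" if "\<eta> \<in> D" for \<eta>
    using flat_tile[OF tiling region that] .
  have "flat_tiling ?h D"
    unfolding flat_tiling_def
  proof (intro conjI ballI allI impI)
    show "\<eta> \<inter> \<eta>' = {}" if "\<eta> \<in> D" "\<eta>' \<in> D" "\<eta> \<noteq> \<eta>'" for \<eta> \<eta>'
      using dyck_tiling_disjoint[OF tiling that] .
    show "\<exists>a' b'. a' \<le> a \<and> b \<le> b' \<and> strip a' b' l \<in> D"
      if "a \<le> b" and D: "strip a b (Suc l) \<in> D" for a b l
    proof -
      have "cell_at a (int (Suc l)) \<in> \<Union>D"
        using D \<open>a \<le> b\<close> in_strip_iff[of a "Suc l" a b "Suc l"] by blast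
      then have a: "a \<le> 2 * N" unfolding union by auto
      have "cell_at a (int l) \<in> shift (strip a b (Suc l))"
        using \<open>a \<le> b\<close> by (simp add: shift_strip_Suc in_strip_iff)
      then have "\<not> (\<forall>c\<in>shift (strip a b (Suc l)). below_path lam c)"
        using below_lam_iff[OF a, of "int l"] by auto
      then obtain \<eta>' where \<eta>': "\<eta>' \<in> D" "strip a b l \<subseteq> \<eta>'"
        using dyck_tiling_cover[OF tiling D] unfolding shift_strip_Suc by blast
      then obtain a' b' l' where "\<eta>' = strip a' b' l'" using flat by blast
      moreover have "cell_at a (int l) \<in> \<eta>'" "cell_at b (int l) \<in> \<eta>'"
        using \<eta>'(2) \<open>a \<le> b\<close> in_strip_iff[of _ l a b l] by auto
      ultimately show ?thesis using \<eta>'(1) by (auto simp: in_strip_iff)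
    qed
    show "strip (2 * N - b) (2 * N - a) l \<in> D" if "a \<le> b" "b \<le> 2 * N" "strip a b l \<in> D" for a b l
      using sym that(3) imageI[of "strip a b l" D "\<lambda>\<eta>. reflect_cell N ` \<eta>"]
      by (simp add: symmetric_tiling_def reflect_strip[OF that(1,2)])
  qed (use flat union in auto)
  then show ?thesis using that profile_of_path[OF mu] by blast
qed

lemma Dsym_of_flat_tiling:
  assumes "profile h" "flat_tiling h D"
  shows "D \<in> Dsym N lam"
proof -
  obtain mu where mu: "dyck_path N mu" "symmetric_path N mu" "weakly_above mu lam"
    and ups: "\<And>m. m \<le> 2 * N \<Longrightarrow> ups mu m = ups lam m + int (h m)"
    using path_of_profile[OF assms(1)] by blast
  note flat = flat_tiling_strip[OF assms(2)]
  have tiling: "dyck_tiling lam mu D"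
    unfolding dyck_tiling_def
  proof (intro conjI ballI impI)
    show "dyck_tile \<eta>" if "\<eta> \<in> D" for \<eta>
      using flat[OF that] dyck_tile_strip by blast
    show "\<Union>D = region lam mu"
      unfolding flat_tiling_union[OF assms(2)] region_eq[OF mu(1,3)] using ups by (intro Collect_cong) auto
    show "(\<forall>c\<in>shift \<eta>. below_path lam c) \<or> (\<exists>\<eta>'\<in>D - {\<eta>}. shift \<eta> \<subseteq> \<eta>')"
      if D: "\<eta> \<in> D" for \<eta>
    proof -
      obtain a b l where \<eta>: "\<eta> = strip a b l" and ab: "a \<le> b" "b \<le> 2 * N"
        using flat[OF D] by (auto simp: dyck_interval_def)
      show ?thesis
      proof (cases l)
        case 0
        have "below_path lam c" if c: "c \<in> shift \<eta>" for c
        proof -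
          obtain m where m: "m \<le> b" "c = cell_at m (- 1)"
            using c unfolding \<eta> 0 shift_def strip_def image_image by (auto simp: shift_cell_at)
          then show ?thesis using below_lam_iff[of m "- 1"] ab by simp
        qed
        then show ?thesis by blast
      next
        case (Suc k)
        obtain a' b' where *: "a' \<le> a" "b \<le> b'" "strip a' b' k \<in> D"
          using flat_tiling_cover[OF assms(2) ab(1), of k] D \<eta> Suc by auto
        then have "strip a' b' k \<noteq> \<eta>"
          using strip_eq_iff[OF ab(1), of l a' b' k] \<eta> Suc by auto
        moreover have "shift \<eta> \<subseteq> strip a' b' k"
          using * unfolding \<eta> Suc shift_strip_Suc by (auto simp: strip_def)
        ultimately show ?thesis using *(3) by blast
      qed
    qed
  qed (rule flat_tiling_disjoint[OF assms(2)])
  have img: "reflect_cell N ` \<eta> \<in> D \<and> reflect_cell N ` reflect_cell N ` \<eta> = \<eta>"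
    if D: "\<eta> \<in> D" for \<eta>
  proof -
    obtain a b l where \<eta>: "\<eta> = strip a b l" and ab: "a \<le> b" "b \<le> 2 * N"
      using flat[OF D] by (auto simp: dyck_interval_def)
    then show ?thesis
      using D flat_tiling_reflect[OF assms(2) ab] reflect_strip[OF ab] reflect_strip[of "2 * N - b" "2 * N - a" l] by simp
  qed
  have "symmetric_tiling N D"
    unfolding symmetric_tiling_def
  proof (intro equalityI subsetI)
    fix \<eta> assume "\<eta> \<in> D"
    then show "\<eta> \<in> (\<lambda>\<eta>. reflect_cell N ` \<eta>) ` D"
      using img[of \<eta>] by (intro image_eqI[of _ _ "reflect_cell N ` \<eta>"]) auto
  qed (use img in auto)
  then show ?thesis using mu tiling by (auto simp: Dsym_def)
qed

end

section \<open>Admissible codes described pointwise\<close>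

definition code_layers :: "nat \<Rightarrow> (nat \<times> nat) list \<Rightarrow> nat \<Rightarrow> nat" where
  "code_layers i xs m = (i # map snd xs) ! m"

definition code_cut :: "(nat \<times> nat) list \<Rightarrow> nat \<Rightarrow> nat" where
  "code_cut xs e = fst (xs ! e)"

lemma code_layers_simps [simp]:
  "code_layers i xs 0 = i"
  "code_layers i ((c, h) # xs) (Suc m) = code_layers h xs m"
  by (simp_all add: code_layers_def)

lemma code_cut_simps [simp]:
  "code_cut ((c, h) # xs) 0 = c"
  "code_cut ((c, h) # xs) (Suc e) = code_cut xs e"
  by (simp_all add: code_cut_def)

definition rel_height :: "step list \<Rightarrow> nat \<Rightarrow> int" where
  "rel_height w m = 2 * ups w m - int m"

lemma rel_height_simps [simp]:
  "rel_height w 0 = 0"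
  "rel_height (Up # w) (Suc m) = 1 + rel_height w m"
  "rel_height (Down # w) (Suc m) = - 1 + rel_height w m"
  by (simp_all add: rel_height_def ups_def)

definition steps_ok :: "step list \<Rightarrow> nat \<Rightarrow> (nat \<times> nat) list \<Rightarrow> bool" where
  "steps_ok w i xs \<longleftrightarrow> (\<forall>m<length w.
     if w ! m = Up
     then code_layers i xs m \<in> {code_layers i xs (Suc m), Suc (code_layers i xs (Suc m))}
     else code_layers i xs (Suc m) \<in> {code_layers i xs m, Suc (code_layers i xs m)})"

definition cuts_ok :: "step list \<Rightarrow> nat \<Rightarrow> (nat \<times> nat) list \<Rightarrow> bool" where
  "cuts_ok w i xs \<longleftrightarrow> (\<forall>e<length w.
     code_cut xs e \<le> code_layers i xs e \<and> code_cut xs e \<le> code_layers i xs (Suc e))"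

text \<open>
  The premises say that step \<open>e\<close> lies between the up step \<open>u\<close> and its matching down step, or is that
  down step; the latter holds if the path returns to the height at which \<open>u\<close> starts.
\<close>
definition matched_ok :: "step list \<Rightarrow> (nat \<times> nat) list \<Rightarrow> bool" where
  "matched_ok w xs \<longleftrightarrow> (\<forall>u e. u < e \<longrightarrow> e < length w \<longrightarrow> w ! u = Up \<longrightarrow>
     (\<forall>m. u < m \<longrightarrow> m \<le> e \<longrightarrow> rel_height w u < rel_height w m) \<longrightarrow>
     code_cut xs u \<le> code_cut xs e \<and>
     (rel_height w (Suc e) = rel_height w u \<longrightarrow> code_cut xs e = code_cut xs u))"

text \<open>
  The same condition for the cut \<open>s\<close> of an up step before the beginning of \<open>w\<close> that occupies
  position \<open>k\<close> of the stack: its matching down step is the first one that reaches relative height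
  \<open>-k - 1\<close>.
\<close>
definition pending_ok :: "step list \<Rightarrow> nat \<Rightarrow> nat \<Rightarrow> (nat \<times> nat) list \<Rightarrow> bool" where
  "pending_ok w k s xs \<longleftrightarrow> (\<forall>e<length w. (\<forall>m\<le>e. - int k \<le> rel_height w m) \<longrightarrow>
     s \<le> code_cut xs e \<and> (rel_height w (Suc e) = - int k - 1 \<longrightarrow> code_cut xs e = s))"

lemma all_nat_Suc: "(\<forall>n. P n) \<longleftrightarrow> P 0 \<and> (\<forall>n. P (Suc n))"
proof (intro iffI allI)
  fix n assume "P 0 \<and> (\<forall>n. P (Suc n))"
  then show "P n" by (cases n) auto
qed simp

lemma all_le_Suc: "(\<forall>m\<le>Suc e. P m) \<longleftrightarrow> P 0 \<and> (\<forall>m\<le>e. P (Suc m))"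
  by (simp only: less_Suc_eq_le[symmetric] All_less_Suc2)

lemma steps_ok_Cons:
  "steps_ok (Up # w) i ((c, h) # xs) \<longleftrightarrow> h \<in> {i - 1..i} \<and> steps_ok w h xs"
  "steps_ok (Down # w) i ((c, h) # xs) \<longleftrightarrow> h \<in> {i, Suc i} \<and> steps_ok w h xs"
  unfolding steps_ok_def length_Cons All_less_Suc2 by auto

lemma cuts_ok_Cons:
  "cuts_ok (s # w) i ((c, h) # xs) \<longleftrightarrow> c \<le> i \<and> c \<le> h \<and> cuts_ok w h xs"
  unfolding cuts_ok_def length_Cons All_less_Suc2 by simp

lemma pending_ok_Cons:
  "pending_ok (Up # w) k s ((c, h) # xs) \<longleftrightarrow> s \<le> c \<and> pending_ok w (Suc k) s xs"
  "pending_ok (Down # w) 0 s ((c, h) # xs) \<longleftrightarrow> c = s"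
  "pending_ok (Down # w) (Suc k) s ((c, h) # xs) \<longleftrightarrow> s \<le> c \<and> pending_ok w k s xs"
proof -
  have e: "(- int k \<le> 1 + x) = (- int (Suc k) \<le> x)" "(1 + x = - int k - 1) = (x = - int (Suc k) - 1)"
    "(- int (Suc k) \<le> - 1 + x) = (- int k \<le> x)" "(- 1 + x = - int (Suc k) - 1) = (x = - int k - 1)"
    for x by auto
  show "pending_ok (Up # w) k s ((c, h) # xs) \<longleftrightarrow> s \<le> c \<and> pending_ok w (Suc k) s xs"
    unfolding pending_ok_def length_Cons All_less_Suc2 all_le_Suc rel_height_simps code_cut_simps e
    by auto
  show "pending_ok (Down # w) (Suc k) s ((c, h) # xs) \<longleftrightarrow> s \<le> c \<and> pending_ok w k s xs"
    unfolding pending_ok_def length_Cons All_less_Suc2 all_le_Suc rel_height_simps code_cut_simps e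
    by auto
  show "pending_ok (Down # w) 0 s ((c, h) # xs) \<longleftrightarrow> c = s"
    unfolding pending_ok_def length_Cons All_less_Suc2 all_le_Suc rel_height_simps code_cut_simps
    by auto
qed

lemma matched_ok_Cons:
  "matched_ok (x # w) ((c, h) # xs) \<longleftrightarrow> (x = Up \<longrightarrow> pending_ok w 0 c xs) \<and> matched_ok w xs"
proof -
  define d where "d = (if x = Up then 1 else - 1 :: int)"
  have rel: "rel_height (x # w) (Suc m) = d + rel_height w m" for m
    by (cases x) (simp_all add: d_def)
  have first: "(\<forall>e. 0 < e \<longrightarrow> e < length (x # w) \<longrightarrow> (x # w) ! 0 = Up \<longrightarrow>
       (\<forall>m. 0 < m \<longrightarrow> m \<le> e \<longrightarrow> rel_height (x # w) 0 < rel_height (x # w) m) \<longrightarrow>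
       code_cut ((c, h) # xs) 0 \<le> code_cut ((c, h) # xs) e \<and>
       (rel_height (x # w) (Suc e) = rel_height (x # w) 0 \<longrightarrow>
         code_cut ((c, h) # xs) e = code_cut ((c, h) # xs) 0))
     \<longleftrightarrow> (x = Up \<longrightarrow> pending_ok w 0 c xs)"
  proof -
    have m0: "(\<forall>m>0. m \<le> Suc n \<longrightarrow> 0 < rel_height (Up # w) m) \<longleftrightarrow>
        (\<forall>m\<le>n. 0 \<le> rel_height w m)" for n
      by (subst all_nat_Suc) auto
    have level: "d + y = 0 \<longleftrightarrow> y = - 1" if "x = Up" for y
      using that by (auto simp: d_def)
    show ?thesis
      apply (subst all_nat_Suc)
      apply (cases "x = Up")
      subgoal
        unfolding pending_ok_def rel rel_height_simps code_cut_simps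
        apply (simp only: nth_Cons_0 length_Cons Suc_less_eq zero_less_Suc simp_thms)
        apply (subst all_nat_Suc)
        apply (simp add: m0 level)
        done
      subgoal by simp
      done
  qed
  have rest: "(\<forall>u e. Suc u < e \<longrightarrow> e < length (x # w) \<longrightarrow> (x # w) ! Suc u = Up \<longrightarrow>
       (\<forall>m. Suc u < m \<longrightarrow> m \<le> e \<longrightarrow> rel_height (x # w) (Suc u) < rel_height (x # w) m) \<longrightarrow>
       code_cut ((c, h) # xs) (Suc u) \<le> code_cut ((c, h) # xs) e \<and>
       (rel_height (x # w) (Suc e) = rel_height (x # w) (Suc u) \<longrightarrow>
         code_cut ((c, h) # xs) e = code_cut ((c, h) # xs) (Suc u)))
     \<longleftrightarrow> matched_ok w xs"
  proof -
    have m: "(\<forall>m. Suc u < m \<longrightarrow> m \<le> Suc e \<longrightarrow> d + rel_height w u < rel_height (x # w) m)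
        \<longleftrightarrow> (\<forall>m. u < m \<longrightarrow> m \<le> e \<longrightarrow> rel_height w u < rel_height w m)" for u e
      by (subst all_nat_Suc) (simp add: rel)
    show ?thesis
      unfolding matched_ok_def
      apply (rule arg_cong[of _ _ All], rule ext)
      apply (subst all_nat_Suc)
      apply (simp add: m rel)
      done
  qed
  show ?thesis
    unfolding first[symmetric] rest[symmetric]
    unfolding matched_ok_def[of "x # w"]
    by (rule all_nat_Suc)
qed

lemma nth_le_top_cut:
  assumes "sorted_wrt (\<ge>) st" "k < length st"
  shows "st ! k \<le> top_cut st"
proof (cases st)
  case (Cons s st')
  then show ?thesis using assms by (cases k) simp_all
qed (use assms in simp)

lemma top_cut_le_iff:
  assumes "sorted_wrt (\<ge>) st"
  shows "top_cut st \<le> c \<longleftrightarrow> (\<forall>k<length st. st ! k \<le> c)"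
proof
  assume "\<forall>k<length st. st ! k \<le> c"
  then show "top_cut st \<le> c" by (cases st) auto
next
  assume "top_cut st \<le> c"
  then show "\<forall>k<length st. st ! k \<le> c" using nth_le_top_cut[OF assms] le_trans by blast
qed

text \<open>
  The local rules that consult the stack amount to a condition on matching steps that no longer
  mentions the stack, and that can be compared with the shapes of tiles.
\<close>
lemma admissible_iff:
  assumes "\<And>m. m \<le> length w \<Longrightarrow> - int (length st) \<le> rel_height w m"
    and "sorted_wrt (\<ge>) st" "top_cut st \<le> i"
  shows "admissible w st i xs \<longleftrightarrow> length xs = length w \<and> steps_ok w i xs \<and> cuts_ok w i xs \<and>
     matched_ok w xs \<and> (\<forall>k<length st. pending_ok w k (st ! k) xs)"
  using assms
proof (induction w arbitrary: st i xs)
  case Nil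
  then show ?case
    by (cases xs) (simp_all add: steps_ok_def cuts_ok_def matched_ok_def pending_ok_def)
next
  case (Cons x w)
  show ?case
  proof (cases xs)
    case Nil
    then show ?thesis by simp
  next
    case xs: (Cons p ys)
    obtain c h where p: "p = (c, h)" by (cases p)
    show ?thesis
    proof (cases x)
      case Up
      note top = top_cut_le_iff[OF Cons(3), of c, symmetric]
      have pre: "- int (length (c # st)) \<le> rel_height w m" if "m \<le> length w" for m
        using Cons(2)[of "Suc m"] that by (simp add: Up)
      have pend: "(\<forall>k<length st. pending_ok (Up # w) k (st ! k) ((c, h) # ys)) \<longleftrightarrow>
          top_cut st \<le> c \<and> (\<forall>k<length st. pending_ok w (Suc k) (st ! k) ys)"
        unfolding pending_ok_Cons top[symmetric] by blast
      have IH: "admissible w (c # st) h ys \<longleftrightarrow> length ys = length w \<and> steps_ok w h ys \<and>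
          cuts_ok w h ys \<and> matched_ok w ys \<and> pending_ok w 0 c ys \<and>
          (\<forall>k<length st. pending_ok w (Suc k) (st ! k) ys)" if "top_cut st \<le> c" "c \<le> h"
      proof -
        have "sorted_wrt (\<ge>) (c # st)" using Cons(3) that(1)[folded top] by (simp add: all_set_conv_all_nth)
        then show ?thesis
          using Cons.IH[of "c # st" h ys, OF pre] that(2)
          by (simp only: length_Cons All_less_Suc2 nth_Cons_0 nth_Cons_Suc top_cut_simps simp_thms)
      qed
      have "c \<le> i" if "h \<in> {i - 1..i}" "c \<le> h" using that by auto
      then show ?thesis
        using IH
        unfolding xs p Up admissible.simps steps_ok_Cons cuts_ok_Cons matched_ok_Cons pend
          length_Cons nat.inject atLeastAtMost_iff[of c] simp_thms
        by argo
    next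
      case Down
      have "st \<noteq> []"
      proof
        assume "st = []"
        then show False using Cons(2)[of 1] by (simp add: Down)
      qed
      then obtain s st' where st: "st = s # st'" by (cases st) auto
      have pre: "- int (length st') \<le> rel_height w m" if "m \<le> length w" for m
        using Cons(2)[of "Suc m"] that by (simp add: Down st)
      have sorted: "sorted_wrt (\<ge>) st'" "\<forall>k<length st'. st' ! k \<le> s" "top_cut st' \<le> s"
        using Cons(3) nth_le_top_cut[OF Cons(3)]
        by (simp_all add: st all_set_conv_all_nth top_cut_le_iff)
      have pend: "(\<forall>k<length st. pending_ok (Down # w) k (st ! k) ((c, h) # ys)) \<longleftrightarrow>
          c = s \<and> (\<forall>k<length st'. pending_ok w k (st' ! k) ys)"
        using sorted(2)
        unfolding st length_Cons All_less_Suc2 nth_Cons_0 nth_Cons_Suc pending_ok_Cons by blast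
      have IH: "admissible w st' h ys \<longleftrightarrow> length ys = length w \<and> steps_ok w h ys \<and>
          cuts_ok w h ys \<and> matched_ok w ys \<and> (\<forall>k<length st'. pending_ok w k (st' ! k) ys)"
        if "h \<in> {i, Suc i}"
        using that sorted Cons(4) by (intro Cons.IH pre) (auto simp: st)
      have "c \<le> i \<and> c \<le> h" if "h \<in> {i, Suc i}" "c = s" using that Cons(4) by (auto simp: st)
      moreover have "Down \<noteq> Up" by simp
      moreover have "admissible (Down # w) st i ((c, h) # ys) \<longleftrightarrow>
          c = s \<and> h \<in> {i, Suc i} \<and> admissible w st' h ys"
        by (simp only: st admissible.simps)
      ultimately show ?thesis
        using IH
        unfolding xs p Down steps_ok_Cons cuts_ok_Cons matched_ok_Cons pend
          length_Cons nat.inject simp_thms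
        by argo
    qed
  qed
qed

section \<open>From codes to tilings\<close>

context symmetric_dyck_path
begin

text \<open>
  Layers and cuts along the whole of \<open>\<lambda>\<close>. The matching condition is imposed on the left half
  only; symmetry transports its consequences to the right half.
\<close>
definition tile_code :: "(nat \<Rightarrow> nat) \<Rightarrow> (nat \<Rightarrow> nat) \<Rightarrow> bool" where
  "tile_code h c \<longleftrightarrow> profile h \<and>
     (\<forall>e<2 * N. c e \<le> h e \<and> c e \<le> h (Suc e) \<and> c (2 * N - Suc e) = c e) \<and>
     (\<forall>u e. u < e \<longrightarrow> e < N \<longrightarrow> lam ! u = Up \<longrightarrow>
        (\<forall>m. u < m \<longrightarrow> m \<le> e \<longrightarrow> height u < height m) \<longrightarrow>
        c u \<le> c e \<and> (height (Suc e) = height u \<longrightarrow> c e = c u))"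

text \<open>
  A maximal set of consecutive points whose cells in layer \<open>l\<close> are joined. No cell lies over the two end points of
  \<open>\<lambda>\<close>, so a run has a step on either side.
\<close>
definition run :: "(nat \<Rightarrow> nat) \<Rightarrow> (nat \<Rightarrow> nat) \<Rightarrow> nat \<Rightarrow> nat \<Rightarrow> nat \<Rightarrow> bool" where
  "run h c a b l \<longleftrightarrow> 0 < a \<and> a \<le> b \<and> b < 2 * N \<and> l < h a \<and>
     (\<forall>e. a \<le> e \<longrightarrow> e < b \<longrightarrow> l < c e) \<and> c (a - 1) \<le> l \<and> c b \<le> l"

definition blocks :: "(nat \<Rightarrow> nat) \<Rightarrow> (nat \<Rightarrow> nat) \<Rightarrow> cell set set" where
  "blocks h c = {strip a b l | a b l. run h c a b l}"

context
  fixes h c :: "nat \<Rightarrow> nat"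
  assumes code: "tile_code h c"
begin

lemma code_profile: "profile h"
  and code_cut_le: "e < 2 * N \<Longrightarrow> c e \<le> h e" "e < 2 * N \<Longrightarrow> c e \<le> h (Suc e)"
  and code_cut_reflect: "e < 2 * N \<Longrightarrow> c (2 * N - Suc e) = c e"
  and code_matched: "\<And>u. u < e \<Longrightarrow> e < N \<Longrightarrow> lam ! u = Up \<Longrightarrow>
        (\<And>m. u < m \<Longrightarrow> m \<le> e \<Longrightarrow> height u < height m) \<Longrightarrow> c u \<le> c e"
  and code_matched_eq: "\<And>u. u < e \<Longrightarrow> e < N \<Longrightarrow> lam ! u = Up \<Longrightarrow>
        (\<And>m. u < m \<Longrightarrow> m \<le> e \<Longrightarrow> height u < height m) \<Longrightarrow>
        height (Suc e) = height u \<Longrightarrow> c e = c u"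
  using code unfolding tile_code_def by (elim conjE; simp)+

lemma code_layers_0: "h 0 = 0" and code_layers_reflect: "m \<le> 2 * N \<Longrightarrow> h (2 * N - m) = h m"
  using code_profile unfolding profile_def by (elim conjE; simp)+

lemma code_layers_top: "h (2 * N) = 0"
  using code_layers_reflect[of 0] code_layers_0 by simp

lemma runD:
  assumes "run h c a b l"
  shows "0 < a" "a \<le> b" "b < 2 * N" "l < h a" "\<And>e. a \<le> e \<Longrightarrow> e < b \<Longrightarrow> l < c e"
    "c (a - 1) \<le> l" "c b \<le> l"
  using assms unfolding run_def by (elim conjE; simp)+

lemma run_layers:
  assumes "run h c a b l" "a \<le> m" "m \<le> b"
  shows "l < h m"
proof (cases "m = a")
  case False
  then obtain e where e: "m = Suc e" "a \<le> e" using assms(2) by (cases m) auto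
  then show ?thesis
    using runD(5)[OF assms(1), of e] runD(3)[OF assms(1)] code_cut_le(2)[of e] assms(3) by simp
qed (use runD(4)[OF assms(1)] in simp)

lemma run_unique:
  assumes "run h c a b l" "run h c a' b' l" "a \<le> m" "m \<le> b" "a' \<le> m" "m \<le> b'"
  shows "a = a' \<and> b = b'"
proof -
  have "a \<le> a'" if "run h c a b l" "run h c a' b' l" "a' \<le> m" "a \<le> m" "m \<le> b'" for a b a' b'
  proof (rule ccontr)
    assume "\<not> a \<le> a'"
    then have "l < c (a - 1)" using runD(5)[OF that(2), of "a - 1"] that by simp
    then show False using runD(6)[OF that(1)] by simp
  qed
  moreover have "b' \<le> b" if "run h c a b l" "run h c a' b' l" "a' \<le> m" "m \<le> b" for a b a' b'
  proof (rule ccontr)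
    assume "\<not> b' \<le> b"
    then have "l < c b" using runD(5)[OF that(2), of b] that by simp
    then show False using runD(7)[OF that(1)] by simp
  qed
  ultimately show ?thesis using assms by (meson le_antisym)
qed

lemma run_exists:
  assumes "m \<le> 2 * N" "l < h m"
  obtains a b where "run h c a b l" "a \<le> m" "m \<le> b"
proof -
  have "m \<noteq> 0" "m \<noteq> 2 * N" using assms(2) code_layers_0 code_layers_top by (metis not_less0)+
  then have m: "0 < m" "m < 2 * N" using assms(1) by auto
  have ends: "c 0 = 0" "c (2 * N - 1) = 0"
    using code_cut_le(1)[of 0] code_cut_reflect[of 0] code_layers_0 m by auto
  define P where "P a \<longleftrightarrow> a \<le> m \<and> (\<forall>e. a \<le> e \<longrightarrow> e < m \<longrightarrow> l < c e)" for a
  define a where "a = (LEAST a. P a)"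
  have "P m" by (simp add: P_def)
  then have a: "P a" unfolding a_def by (rule LeastI)
  have "a \<noteq> 0"
  proof
    assume "a = 0"
    then have "l < c 0" using a m by (simp add: P_def)
    then show False by (simp add: ends)
  qed
  moreover have left: "c (a - 1) \<le> l"
  proof (rule ccontr)
    assume "\<not> c (a - 1) \<le> l"
    have "P (a - 1)"
      unfolding P_def
    proof (intro conjI allI impI)
      fix e assume "a - 1 \<le> e" "e < m"
      then show "l < c e"
        using a \<open>\<not> c (a - 1) \<le> l\<close> by (cases "e = a - 1") (auto simp: P_def)
    qed (use a in \<open>auto simp: P_def\<close>)
    then have "a \<le> a - 1" unfolding a_def by (rule Least_le)
    then show False using \<open>a \<noteq> 0\<close> by simp
  qed
  define Q where "Q b \<longleftrightarrow> m \<le> b \<and> c b \<le> l" for b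
  define b where "b = (LEAST b. Q b)"
  have Q0: "Q (2 * N - 1)" using m ends by (simp add: Q_def)
  then have b: "Q b" unfolding b_def by (rule LeastI)
  have "b \<le> 2 * N - 1" unfolding b_def by (rule Least_le[of Q, OF Q0])
  moreover have "l < c e" if "m \<le> e" "e < b" for e
    using not_less_Least[of e Q] that unfolding b_def Q_def by auto
  then have inner: "l < c e" if "a \<le> e" "e < b" for e
    using that a unfolding P_def by (cases "e < m") auto
  moreover have "l < h a"
  proof (cases "a = m")
    case False
    then have "l < c a" using a by (simp add: P_def)
    then show ?thesis using code_cut_le(1)[of a] a m by (simp add: P_def)
  qed (use assms(2) in simp)
  ultimately have "run h c a b l"
    using a b m left by (auto simp: run_def P_def Q_def)
  then show ?thesis using that a b by (auto simp: P_def Q_def)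
qed

lemma run_reflect:
  assumes "run h c a b l"
  shows "run h c (2 * N - b) (2 * N - a) l"
proof -
  note r = runD[OF assms]
  have refl: "c (2 * N - e) = c (e - 1)" if "0 < e" "e < 2 * N" for e
    using code_cut_reflect[of "e - 1"] that by simp
  show ?thesis
    unfolding run_def
  proof (intro conjI allI impI)
    show "l < h (2 * N - b)"
      using run_layers[OF assms r(2) le_refl] r(3) by (simp add: code_layers_reflect)
    show "l < c e" if "2 * N - b \<le> e" "e < 2 * N - a" for e
      using r(5)[of "2 * N - Suc e"] code_cut_reflect[of e] that r(1-3) by simp
    show "c (2 * N - b - 1) \<le> l"
      using code_cut_reflect[of b] r by simp
    show "c (2 * N - a) \<le> l" using refl[of a] r by simp
  qed (use r in auto)
qed

text \<open>
  If the path fell below its height at the left end of a run, the first step below that height would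
  match an up step before the run. Its cut would equal that of a step inside the run, hence exceed \<open>l\<close>, and
  so would the cut of the step just before the run, contrary to maximality.
\<close>
lemma run_ge_left:
  assumes "run h c a b l" "a \<le> m" "m \<le> b" "m \<le> N"
  shows "height a \<le> height m"
proof (rule ccontr)
  note r = runD[OF assms(1)]
  assume "\<not> height a \<le> height m"
  define P where "P m \<longleftrightarrow> a \<le> m \<and> height m < height a" for m
  \<comment> \<open>The path reaches n by a down step e; let u be the up step matching it.\<close>
  define n where "n = (LEAST m. P m)"
  have "P m" using assms(2) \<open>\<not> height a \<le> height m\<close> by (simp add: P_def)
  then have n: "P n" "n \<le> m" unfolding n_def by (rule LeastI, rule Least_le)
  have "n \<noteq> a" using n(1) by (auto simp: P_def)
  then obtain e where e: "n = Suc e" "a \<le> e" using n(1) by (cases n) (auto simp: P_def)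
  have ge: "height a \<le> height k" if "a \<le> k" "k \<le> e" for k
  proof -
    have "\<not> P k" by (rule not_less_Least) (use that e(1) in \<open>simp flip: n_def\<close>)
    then show ?thesis using that(1) by (simp add: P_def)
  qed
  have eN: "e < N" "e < 2 * N" "e < b" using e n(2) assms by auto
  define u where "u = (GREATEST u. u \<le> a \<and> height u \<le> height n)"
  \<comment> \<open>u exists because the path starts at height 0.\<close>
  have ex: "0 \<le> a \<and> height 0 \<le> height n"
    using height_nonneg[of n] n(2) assms(4) by (simp add: height_def)
  have u: "u \<le> a" "height u \<le> height n"
    using GreatestI_nat[of "\<lambda>u. u \<le> a \<and> height u \<le> height n", OF ex, of a] by (auto simp: u_def)
  have above: "height n < height k" if "u < k" "k \<le> a" for k
    using Greatest_le_nat[of "\<lambda>u. u \<le> a \<and> height u \<le> height n" k a] that unfolding u_def[symmetric]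
    by (auto simp: not_le[symmetric])
  have "u \<noteq> a" using u(2) n(1) by (auto simp: P_def)
  then have ua: "u < a" using u(1) by simp
  have u_step: "lam ! u = Up" "height u = height n"
    using above[of "Suc u"] ua u(2) height_Suc[of u] r(2,3) by (auto split: if_splits)
  have inside: "height u < height k" if "u < k" "k \<le> e" for k
    using above[of k] ge[of k] n(1) u_step(2) that unfolding P_def by (cases "k \<le> a") auto
  have "u < e" using ua e(2) by simp
  then have "c e = c u"
    using code_matched_eq[OF _ eN(1) u_step(1) inside] e(1) u_step(2) by simp
  moreover have "l < c e" using r(5)[of e] e(2) eN by simp
  moreover have "c u \<le> c (a - 1)"
  proof (cases "u = a - 1")
    case False
    show ?thesis
      by (rule code_matched[OF _ _ u_step(1) inside]) (use False ua e eN in auto)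
  qed simp
  ultimately show False using r(6) by simp
qed

text \<open>
  If a point of the run were lower than its right end, the last such point would start an up step
  that is still unmatched at the right end, and whose cut exceeds \<open>l\<close>. So would the cut of the step just
  after the run, contrary to maximality.
\<close>
lemma run_ge_right:
  assumes "run h c a b l" "a \<le> m" "m \<le> b" "b < N"
  shows "height b \<le> height m"
proof (rule ccontr)
  note r = runD[OF assms(1)]
  assume *: "\<not> height b \<le> height m"
  \<comment> \<open>The last point of the run below its right end starts an up step without a match before b.\<close>
  define P where "P u \<longleftrightarrow> u \<le> b \<and> height u < height b" for u
  define u where "u = (GREATEST u. P u)"
  have Pm: "P m" using assms(3) * by (simp add: P_def)
  have bound: "\<And>y. P y \<Longrightarrow> y \<le> b" by (simp add: P_def)
  have u: "P u" unfolding u_def by (rule GreatestI_nat[of P, OF Pm bound])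
  have "m \<le> u" unfolding u_def by (rule Greatest_le_nat[of P, OF Pm bound])
  have "u \<noteq> b" using u by (auto simp: P_def)
  then have ub: "u < b" using u by (simp add: P_def)
  have above: "height b \<le> height k" if "u < k" "k \<le> b" for k
    using Greatest_le_nat[of P k b] bound that unfolding u_def[symmetric] by (force simp: P_def)
  have inside: "height u < height k" if "u < k" "k \<le> b" for k
    using above[OF that] u by (simp add: P_def)
  have "lam ! u = Up"
    using inside[of "Suc u"] ub height_Suc[of u] r(3) by (auto split: if_splits)
  then have "c u \<le> c b" using code_matched[OF ub assms(4) _ inside] by simp
  moreover have "l < c u" using r(5)[of u] assms(2) \<open>m \<le> u\<close> ub by simp
  ultimately show False using r(7) by simp
qed

lemma dyck_interval_reflect:
  assumes "dyck_interval a b"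
  shows "dyck_interval (2 * N - b) (2 * N - a)"
proof -
  have ab: "a \<le> b" "b \<le> 2 * N" "height a = height b"
    and ge: "\<And>m. a \<le> m \<Longrightarrow> m \<le> b \<Longrightarrow> height a \<le> height m"
    using assms by (auto simp: dyck_interval_def)
  show ?thesis
    unfolding dyck_interval_def
  proof (intro conjI ballI)
    fix m assume "m \<in> {2 * N - b..2 * N - a}"
    then have "a \<le> 2 * N - m" "2 * N - m \<le> b" "m \<le> 2 * N" using ab by auto
    then show "height (2 * N - b) \<le> height m"
      using ge[of "2 * N - m"] ab height_reflect[of m] height_reflect[of b] by simp
  qed (use ab height_reflect[of a] height_reflect[of b] in auto)
qed

text \<open>
  Runs within the left half are settled by the two preceding estimates and runs within the right half by reflection.
  A run across the center equals its own reflection, because runs are disjoint.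
\<close>
lemma run_dyck_interval:
  assumes "run h c a b l"
  shows "dyck_interval a b"
proof -
  have left: "dyck_interval a b" if run: "run h c a b l" and "b < N" for a b
  proof -
    note r = runD[OF run]
    have "height a = height b"
      using run_ge_left[OF run r(2) le_refl] run_ge_right[OF run le_refl r(2)] that(2) by simp
    then show ?thesis
      using run_ge_left[OF run] r that(2) by (auto simp: dyck_interval_def)
  qed
  note r = runD[OF assms]
  consider "b < N" | "N < a" | "a \<le> N" "N \<le> b" by linarith
  then show ?thesis
  proof cases
    case 1
    then show ?thesis using left assms by simp
  next
    case 2
    then have "dyck_interval (2 * N - b) (2 * N - a)"
      using left[OF run_reflect[OF assms]] r by simp
    then show ?thesis using dyck_interval_reflect[of "2 * N - b" "2 * N - a"] r by simp
  next
    case 3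
    have b: "b = 2 * N - a"
      using run_unique[OF assms run_reflect[OF assms], of N] 3 by simp
    have ge: "height a \<le> height m" if "a \<le> m" "m \<le> b" for m
    proof (cases "m \<le> N")
      case True
      then show ?thesis using run_ge_left[OF assms that] by simp
    next
      case False
      then show ?thesis
        using run_ge_left[OF assms, of "2 * N - m"] that 3 b height_reflect[of m] by simp
    qed
    then show ?thesis
      using height_reflect[of a] b r by (simp add: dyck_interval_def)
  qed
qed

lemma strip_in_blocks: "a \<le> b \<Longrightarrow> strip a b l \<in> blocks h c \<longleftrightarrow> run h c a b l"
  by (auto simp: blocks_def strip_eq_iff)

lemma cell_in_blocks:
  "cell_at m (int l) \<in> \<Union>(blocks h c) \<longleftrightarrow> m \<le> 2 * N \<and> l < h m"
proof
  assume "cell_at m (int l) \<in> \<Union>(blocks h c)"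
  then obtain a b l' where "run h c a b l'" "cell_at m (int l) \<in> strip a b l'"
    by (auto simp: blocks_def)
  then show "m \<le> 2 * N \<and> l < h m"
    using run_layers[of a b l' m] runD(3)[of a b l'] by (auto simp: in_strip_iff)
next
  assume "m \<le> 2 * N \<and> l < h m"
  then obtain a b where "run h c a b l" "a \<le> m" "m \<le> b" using run_exists by blast
  then show "cell_at m (int l) \<in> \<Union>(blocks h c)"
    by (intro UnionI[of "strip a b l"]) (auto simp: blocks_def in_strip_iff)
qed

lemma joined_in_blocks:
  assumes "e < 2 * N"
  shows "(\<exists>\<eta>\<in>blocks h c. cell_at e (int l) \<in> \<eta> \<and> cell_at (Suc e) (int l) \<in> \<eta>) \<longleftrightarrow> l < c e"
proof
  assume "\<exists>\<eta>\<in>blocks h c. cell_at e (int l) \<in> \<eta> \<and> cell_at (Suc e) (int l) \<in> \<eta>"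
  then obtain a b where "run h c a b l" "a \<le> e" "Suc e \<le> b"
    by (auto simp: blocks_def in_strip_iff)
  then show "l < c e" using runD(5) by simp
next
  assume l: "l < c e"
  then have "l < h e" using code_cut_le(1)[OF assms] by simp
  then obtain a b where r: "run h c a b l" "a \<le> e" "e \<le> b"
    using run_exists[of e l] assms by auto
  then have "e \<noteq> b" using runD(7)[OF r(1)] l by auto
  then show "\<exists>\<eta>\<in>blocks h c. cell_at e (int l) \<in> \<eta> \<and> cell_at (Suc e) (int l) \<in> \<eta>"
    using r by (intro bexI[of _ "strip a b l"]) (auto simp: in_strip_iff blocks_def)
qed

lemma flat_tiling_blocks: "flat_tiling h (blocks h c)"
  unfolding flat_tiling_def
proof (intro conjI ballI allI impI)
  show "\<exists>a b l. \<eta> = strip a b l \<and> dyck_interval a b" if \<eta>: "\<eta> \<in> blocks h c" for \<eta>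
  proof -
    obtain a b l where "\<eta> = strip a b l" "run h c a b l" using \<eta> by (auto simp: blocks_def)
    then show ?thesis using run_dyck_interval by blast
  qed
  show "\<eta> \<inter> \<eta>' = {}" if \<eta>: "\<eta> \<in> blocks h c" "\<eta>' \<in> blocks h c" "\<eta> \<noteq> \<eta>'" for \<eta> \<eta>'
  proof (rule ccontr)
    assume ne: "\<eta> \<inter> \<eta>' \<noteq> {}"
    obtain a b l a' b' l' where r: "\<eta> = strip a b l" "run h c a b l"
      "\<eta>' = strip a' b' l'" "run h c a' b' l'"
      using \<eta>(1,2) by (auto simp: blocks_def)
    obtain m where "a \<le> m" "m \<le> b" "cell_at m (int l) \<in> \<eta>'"
      using ne unfolding r(1) by (auto simp: strip_def)
    then have "l = l'" "a' \<le> m" "m \<le> b'" unfolding r(3) by (auto simp: in_strip_iff)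
    then show False
      using run_unique[OF r(2), of a' b' m] r \<open>a \<le> m\<close> \<open>m \<le> b\<close> \<eta>(3) by auto
  qed
  have cells: "\<exists>m l. x = cell_at m (int l)" if "x \<in> \<Union>(blocks h c)" for x
    using that by (auto simp: blocks_def strip_def)
  show "\<Union>(blocks h c) = {cell_at m (int l) | m l. m \<le> 2 * N \<and> l < h m}"
  proof (intro equalityI subsetI)
    fix x assume x: "x \<in> \<Union>(blocks h c)"
    then obtain m l where "x = cell_at m (int l)" using cells by blast
    then show "x \<in> {cell_at m (int l) | m l. m \<le> 2 * N \<and> l < h m}"
      using x cell_in_blocks[of m l] by blast
  qed (use cell_in_blocks in blast)
  show "\<exists>a' b'. a' \<le> a \<and> b \<le> b' \<and> strip a' b' l \<in> blocks h c"
    if ab: "a \<le> b" and D: "strip a b (Suc l) \<in> blocks h c" for a b l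
  proof -
    have r: "run h c a b (Suc l)" using strip_in_blocks[OF ab] D by simp
    obtain a' b' where r': "run h c a' b' l" "a' \<le> a" "a \<le> b'"
      using run_exists[of a l] runD[OF r] by auto
    have "b \<le> b'"
    proof (rule ccontr)
      assume "\<not> b \<le> b'"
      then have "Suc l < c b'" using runD(5)[OF r, of b'] r' by simp
      then show False using runD(7)[OF r'(1)] by simp
    qed
    then show ?thesis
      using r' strip_in_blocks[of a' b' l] by (intro exI[of _ a'] exI[of _ b']) auto
  qed
  show "strip (2 * N - b) (2 * N - a) l \<in> blocks h c"
    if ab: "a \<le> b" "b \<le> 2 * N" and D: "strip a b l \<in> blocks h c" for a b l
    using run_reflect[of a b l] strip_in_blocks[OF ab(1)] D by (auto simp: blocks_def)
qed

end

end

section \<open>The bijection between codes and tilings\<close>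

text \<open>
  Used to count layers: a finite set of layers that is closed downwards is an initial segment.
\<close>
lemma mem_iff_less_card:
  assumes "finite S" "\<And>l :: nat. Suc l \<in> S \<Longrightarrow> l \<in> S"
  shows "l \<in> S \<longleftrightarrow> l < card S"
proof -
  have down: "l \<in> S" if "l \<le> k" "k \<in> S" for l k
    using that by (induction k arbitrary: l rule: less_induct)
      (metis assms(2) le_Suc_eq lessI not0_implies_Suc le_zero_eq)
  have "S = {..<card S}"
  proof (cases "S = {}")
    case False
    then have "S = {..Max S}"
      using Max_in[OF assms(1)] Max_ge[OF assms(1)] down by blast
    then show ?thesis by (metis card_atMost lessThan_Suc_atMost)
  qed simp
  then show ?thesis by blast
qed

context symmetric_dyck_path
begin

text \<open>
  A code of the left half is continued to the right half by symmetry: \<open>min m (2 * N - m)\<close> folds the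
  points and \<open>min e (2 * N - Suc e)\<close> the steps.
\<close>
definition full_layers :: "(nat \<times> nat) list \<Rightarrow> nat \<Rightarrow> nat" where
  "full_layers xs m = code_layers 0 xs (min m (2 * N - m))"

definition full_cut :: "(nat \<times> nat) list \<Rightarrow> nat \<Rightarrow> nat" where
  "full_cut xs e = code_cut xs (min e (2 * N - Suc e))"

definition tiling_of :: "(nat \<times> nat) list \<Rightarrow> cell set set" where
  "tiling_of xs = blocks (full_layers xs) (full_cut xs)"

definition layers_of :: "cell set set \<Rightarrow> nat \<Rightarrow> nat" where
  "layers_of D m = card {l. cell_at m (int l) \<in> \<Union>D}"

definition joined :: "cell set set \<Rightarrow> nat \<Rightarrow> nat \<Rightarrow> bool" where
  "joined D e l \<longleftrightarrow> (\<exists>\<eta>\<in>D. cell_at e (int l) \<in> \<eta> \<and> cell_at (Suc e) (int l) \<in> \<eta>)"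

definition cut_of :: "cell set set \<Rightarrow> nat \<Rightarrow> nat" where
  "cut_of D e = card {l. joined D e l}"

definition encode :: "(nat \<Rightarrow> nat) \<Rightarrow> (nat \<Rightarrow> nat) \<Rightarrow> (nat \<times> nat) list" where
  "encode h c = map (\<lambda>e. (c e, h (Suc e))) [0..<N]"

definition half_codes :: "(nat \<times> nat) list set" where
  "half_codes = {xs. admissible (take N lam) [] 0 xs}"

lemma half_codes_iff:
  "xs \<in> half_codes \<longleftrightarrow> length xs = N \<and>
     (\<forall>m<N. if lam ! m = Up
        then code_layers 0 xs m \<in> {code_layers 0 xs (Suc m), Suc (code_layers 0 xs (Suc m))}
        else code_layers 0 xs (Suc m) \<in> {code_layers 0 xs m, Suc (code_layers 0 xs m)}) \<and>
     (\<forall>e<N. code_cut xs e \<le> code_layers 0 xs e \<and> code_cut xs e \<le> code_layers 0 xs (Suc e)) \<and>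
     (\<forall>u e. u < e \<longrightarrow> e < N \<longrightarrow> lam ! u = Up \<longrightarrow>
        (\<forall>m. u < m \<longrightarrow> m \<le> e \<longrightarrow> height u < height m) \<longrightarrow>
        code_cut xs u \<le> code_cut xs e \<and> (height (Suc e) = height u \<longrightarrow> code_cut xs e = code_cut xs u))"
proof -
  let ?w = "take N lam"
  have len: "length ?w = N" by (simp add: length_lam)
  have rel: "rel_height ?w m = height m" if "m \<le> N" for m
    using that by (simp add: rel_height_def height_def ups_take)
  have "- int (length []) \<le> rel_height ?w m" if "m \<le> length ?w" for m
    using that len rel height_nonneg[of m] by (simp add: height_def)
  then have "xs \<in> half_codes \<longleftrightarrow> length xs = N \<and> steps_ok ?w 0 xs \<and> cuts_ok ?w 0 xs \<and> matched_ok ?w xs"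
    unfolding half_codes_def mem_Collect_eq by (subst admissible_iff) (simp_all add: len del: length_take)
  moreover have "matched_ok ?w xs \<longleftrightarrow> (\<forall>u e. u < e \<longrightarrow> e < N \<longrightarrow> lam ! u = Up \<longrightarrow>
        (\<forall>m. u < m \<longrightarrow> m \<le> e \<longrightarrow> height u < height m) \<longrightarrow>
        code_cut xs u \<le> code_cut xs e \<and> (height (Suc e) = height u \<longrightarrow> code_cut xs e = code_cut xs u))"
    unfolding matched_ok_def len
    by (intro iff_allI imp_cong refl conj_cong) (simp_all add: rel)
  moreover have "steps_ok ?w 0 xs \<longleftrightarrow> (\<forall>m<N. if lam ! m = Up
        then code_layers 0 xs m \<in> {code_layers 0 xs (Suc m), Suc (code_layers 0 xs (Suc m))}
        else code_layers 0 xs (Suc m) \<in> {code_layers 0 xs m, Suc (code_layers 0 xs m)})"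
    unfolding steps_ok_def len by (intro iff_allI imp_cong refl) simp
  moreover have "cuts_ok ?w 0 xs \<longleftrightarrow>
     (\<forall>e<N. code_cut xs e \<le> code_layers 0 xs e \<and> code_cut xs e \<le> code_layers 0 xs (Suc e))"
    unfolding cuts_ok_def len ..
  ultimately show ?thesis by simp
qed

lemma full_left:
  "m \<le> N \<Longrightarrow> full_layers xs m = code_layers 0 xs m"
  "e < N \<Longrightarrow> full_cut xs e = code_cut xs e"
proof -
  show "full_layers xs m = code_layers 0 xs m" if "m \<le> N"
  proof -
    have "min m (2 * N - m) = m" using that by linarith
    then show ?thesis by (simp add: full_layers_def)
  qed
  show "full_cut xs e = code_cut xs e" if "e < N"
  proof -
    have "min e (2 * N - Suc e) = e" using that by linarith
    then show ?thesis by (simp add: full_cut_def)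
  qed
qed

lemma full_reflect:
  "m \<le> 2 * N \<Longrightarrow> full_layers xs (2 * N - m) = full_layers xs m"
  "e < 2 * N \<Longrightarrow> full_cut xs (2 * N - Suc e) = full_cut xs e"
  by (simp_all add: full_layers_def full_cut_def min.commute Suc_diff_Suc)

lemma tile_code_full:
  assumes "xs \<in> half_codes"
  shows "tile_code (full_layers xs) (full_cut xs)"
proof -
  let ?h = "full_layers xs" and ?c = "full_cut xs"
  have step: "if lam ! m = Up then ?h m \<in> {?h (Suc m), Suc (?h (Suc m))}
              else ?h (Suc m) \<in> {?h m, Suc (?h m)}" if "m < N" for m
  proof -
    have "if lam ! m = Up
        then code_layers 0 xs m \<in> {code_layers 0 xs (Suc m), Suc (code_layers 0 xs (Suc m))}
        else code_layers 0 xs (Suc m) \<in> {code_layers 0 xs m, Suc (code_layers 0 xs m)}"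
      using assms that unfolding half_codes_iff by blast
    then show ?thesis using that by (simp only: full_left less_imp_le Suc_leI)
  qed
  have cut: "?c e \<le> ?h e \<and> ?c e \<le> ?h (Suc e)" if "e < N" for e
    using assms that by (simp add: half_codes_iff full_left)
  have right: "?h m = ?h (Suc (2 * N - Suc m)) \<and> ?h (Suc m) = ?h (2 * N - Suc m) \<and>
      ?c m = ?c (2 * N - Suc m) \<and> (lam ! m = Up \<longleftrightarrow> lam ! (2 * N - Suc m) \<noteq> Up) \<and> 2 * N - Suc m < N"
    if "N \<le> m" "m < 2 * N" for m
    using full_reflect(1)[of m xs] full_reflect(1)[of "Suc m" xs] full_reflect(2)[of m xs]
      step_reflect[of m] that by (auto simp: Suc_diff_Suc)
  have "profile ?h"
    unfolding profile_def
  proof (intro conjI allI impI)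
    show "?h 0 = 0" by (simp add: full_left)
    show "?h (2 * N - m) = ?h m" if "m \<le> 2 * N" for m using full_reflect(1)[OF that] .
    show "if lam ! m = Up then ?h m \<in> {?h (Suc m), Suc (?h (Suc m))}
          else ?h (Suc m) \<in> {?h m, Suc (?h m)}" if "m < 2 * N" for m
    proof (cases "m < N")
      case False
      then show ?thesis using right[of m] step[of "2 * N - Suc m"] that by (auto split: if_splits)
    qed (rule step)
  qed
  moreover have "?c e \<le> ?h e \<and> ?c e \<le> ?h (Suc e) \<and> ?c (2 * N - Suc e) = ?c e" if "e < 2 * N" for e
  proof (cases "e < N")
    case True
    then show ?thesis using cut[of e] full_reflect(2)[OF that] by simp
  next
    case False
    then show ?thesis
      using right[of e] cut[of "2 * N - Suc e"] full_reflect(2)[OF that] that by simp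
  qed
  moreover have "?c u \<le> ?c e \<and> (height (Suc e) = height u \<longrightarrow> ?c e = ?c u)"
    if "u < e" "e < N" "lam ! u = Up" "\<forall>m. u < m \<longrightarrow> m \<le> e \<longrightarrow> height u < height m" for u e
    using assms that unfolding half_codes_iff by (simp add: full_left)
  ultimately show ?thesis unfolding tile_code_def by blast
qed

lemma encode_code:
  assumes "tile_code h c"
  shows "encode h c \<in> half_codes"
    and full_layers_encode: "m \<le> 2 * N \<Longrightarrow> full_layers (encode h c) m = h m"
    and full_cut_encode: "e < 2 * N \<Longrightarrow> full_cut (encode h c) e = c e"
proof -
  have h: "code_layers 0 (encode h c) m = h m" if "m \<le> N" for m
    using that code_layers_0[OF assms]
    by (cases m) (simp_all add: code_layers_def encode_def)
  have c: "code_cut (encode h c) e = c e" if "e < N" for e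
    using that by (simp add: code_cut_def encode_def)
  show full_h: "full_layers (encode h c) m = h m" if "m \<le> 2 * N" for m
  proof (cases "m \<le> N")
    case False
    then have "full_layers (encode h c) m = h (2 * N - m)"
      by (simp add: full_layers_def h)
    then show ?thesis using code_layers_reflect[OF assms that] by simp
  qed (simp add: full_left h)
  show full_c: "full_cut (encode h c) e = c e" if "e < 2 * N" for e
  proof (cases "e < N")
    case False
    then have "min e (2 * N - Suc e) = 2 * N - Suc e" "2 * N - Suc e < N" using that by linarith+
    then have "full_cut (encode h c) e = c (2 * N - Suc e)"
      by (simp add: full_cut_def c)
    then show ?thesis using code_cut_reflect[OF assms that] by simp
  qed (simp add: full_left c)
  have prof: "if lam ! m = Up then h m \<in> {h (Suc m), Suc (h (Suc m))}
          else h (Suc m) \<in> {h m, Suc (h m)}" if "m < N" for m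
  proof -
    have "m < 2 * N" using that by simp
    then show ?thesis using code_profile[OF assms] unfolding profile_def by blast
  qed
  show "encode h c \<in> half_codes"
    unfolding half_codes_iff
  proof (intro conjI allI impI)
    show "length (encode h c) = N" by (simp add: encode_def)
  next
    fix m assume "m < N"
    then show "if lam ! m = Up
        then code_layers 0 (encode h c) m \<in> {code_layers 0 (encode h c) (Suc m), Suc (code_layers 0 (encode h c) (Suc m))}
        else code_layers 0 (encode h c) (Suc m) \<in> {code_layers 0 (encode h c) m, Suc (code_layers 0 (encode h c) m)}"
      using prof[OF \<open>m < N\<close>] by (simp only: h less_imp_le Suc_leI)
  qed (use code_cut_le[OF assms] code_matched[OF assms] code_matched_eq[OF assms] in
        \<open>simp_all add: h c\<close>)
qed

lemma blocks_cong:
  assumes "\<And>m. m \<le> 2 * N \<Longrightarrow> h m = h' m" "\<And>e. e < 2 * N \<Longrightarrow> c e = c' e"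
  shows "blocks h c = blocks h' c'"
proof -
  have "run h c a b l \<longleftrightarrow> run h' c' a b l" for a b l
    unfolding run_def using assms by (intro conj_cong refl iff_allI imp_cong) auto
  then show ?thesis by (simp add: blocks_def)
qed

lemma encode_cong:
  assumes "\<And>m. m \<le> 2 * N \<Longrightarrow> h m = h' m" "\<And>e. e < 2 * N \<Longrightarrow> c e = c' e"
  shows "encode h c = encode h' c'"
  using assms by (simp add: encode_def)

lemma of_blocks:
  assumes "tile_code h c"
  shows "m \<le> 2 * N \<Longrightarrow> layers_of (blocks h c) m = h m"
    and "e < 2 * N \<Longrightarrow> cut_of (blocks h c) e = c e"
proof -
  show "layers_of (blocks h c) m = h m" if "m \<le> 2 * N"
    unfolding layers_of_def cell_in_blocks[OF assms] using that by simp
  show "cut_of (blocks h c) e = c e" if "e < 2 * N"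
    unfolding cut_of_def joined_def joined_in_blocks[OF assms that] by simp
qed

context
  fixes h :: "nat \<Rightarrow> nat" and D :: "cell set set"
  assumes prof: "profile h" and flat: "flat_tiling h D"
begin

lemma flat_strip:
  assumes "\<eta> \<in> D" "cell_at m (int l) \<in> \<eta>"
  obtains a b where "\<eta> = strip a b l" "a \<le> m" "m \<le> b" "dyck_interval a b"
proof -
  obtain a b l' where \<eta>: "\<eta> = strip a b l'" and dyck: "dyck_interval a b"
    using flat_tiling_strip[OF flat assms(1)] by blast
  have "l = l'" "a \<le> m" "m \<le> b"
    using assms(2) unfolding \<eta> by (auto simp: in_strip_iff)
  then show ?thesis using that \<eta> dyck by simp
qed

lemma flat_cell_iff: "cell_at m (int l) \<in> \<Union>D \<longleftrightarrow> m \<le> 2 * N \<and> l < h m"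
  unfolding flat_tiling_union[OF flat] by auto

lemma joinedE:
  assumes "joined D e l"
  obtains a b where "strip a b l \<in> D" "a \<le> e" "e < b" "dyck_interval a b"
proof -
  obtain \<eta> where \<eta>: "\<eta> \<in> D" "cell_at e (int l) \<in> \<eta>" "cell_at (Suc e) (int l) \<in> \<eta>"
    using assms by (auto simp: joined_def)
  obtain a b where ab: "\<eta> = strip a b l" "a \<le> e" "dyck_interval a b"
    using flat_strip[OF \<eta>(1,2)] by blast
  then have "e < b" using \<eta>(3) by (simp add: in_strip_iff)
  then show ?thesis using that ab \<eta>(1) by simp
qed

lemma joinedI: "strip a b l \<in> D \<Longrightarrow> a \<le> e \<Longrightarrow> e < b \<Longrightarrow> joined D e l"
  unfolding joined_def by (intro bexI[of _ "strip a b l"]) (simp_all add: in_strip_iff)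

lemma joined_layers: "joined D e l \<Longrightarrow> l < h e \<and> l < h (Suc e)"
  using flat_cell_iff[of e l] flat_cell_iff[of "Suc e" l] unfolding joined_def by blast

text \<open>
  The condition on translates says that cells joined in one layer have joined cells below them, so the
  number of layers in which a step is joined determines which layers they are.
\<close>
lemma joined_iff: "joined D e l \<longleftrightarrow> l < cut_of D e"
proof -
  have "l \<in> {l. joined D e l} \<longleftrightarrow> l < card {l. joined D e l}"
  proof (rule mem_iff_less_card)
    show "finite {l. joined D e l}"
      by (rule finite_subset[of _ "{..<h e}"]) (use joined_layers in auto)
    show "l \<in> {l. joined D e l}" if suc: "Suc l \<in> {l. joined D e l}" for l
    proof -
      obtain a b where ab: "strip a b (Suc l) \<in> D" "a \<le> e" "e < b"
        using joinedE[of e "Suc l"] suc by blast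
      then obtain a' b' where "a' \<le> a" "b \<le> b'" "strip a' b' l \<in> D"
        using flat_tiling_cover[OF flat, of a b l] by auto
      then show ?thesis using joinedI[of a' b' l e] ab by simp
    qed
  qed
  then show ?thesis by (simp add: cut_of_def)
qed

lemma joined_reflect:
  assumes "e < 2 * N" "joined D e l"
  shows "joined D (2 * N - Suc e) l"
proof -
  obtain a b where ab: "strip a b l \<in> D" "a \<le> e" "e < b" "dyck_interval a b"
    using joinedE[OF assms(2)] .
  then have "strip (2 * N - b) (2 * N - a) l \<in> D"
    using flat_tiling_reflect[OF flat, of a b l] by (simp add: dyck_interval_def)
  then show ?thesis
    by (rule joinedI) (use ab assms in \<open>auto simp: dyck_interval_def\<close>)
qed

lemma cut_of_le: "cut_of D e \<le> h e" "cut_of D e \<le> h (Suc e)"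
  using joined_layers joined_iff by (meson not_le less_irrefl)+

lemma cut_of_reflect:
  assumes "e < 2 * N"
  shows "cut_of D (2 * N - Suc e) = cut_of D e"
proof -
  have "joined D (2 * N - Suc e) l \<longleftrightarrow> joined D e l" for l
    using joined_reflect[OF assms, of l] joined_reflect[of "2 * N - Suc e" l] assms by auto
  then show ?thesis by (simp add: cut_of_def)
qed

text \<open>
  A tile that contains both ends of an up step \<open>u\<close> starts at a height not above that of \<open>u\<close>, and being a
  Dyck path it ends there. It therefore reaches at least to the end of the matching down step. The
  same argument read backwards gives equality.
\<close>
lemma cut_of_matched:
  assumes "u < e" "lam ! u = Up" "\<And>m. u < m \<Longrightarrow> m \<le> e \<Longrightarrow> height u < height m"
  shows "cut_of D u \<le> cut_of D e"
    and "height (Suc e) = height u \<Longrightarrow> cut_of D e = cut_of D u"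
proof -
  show le: "cut_of D u \<le> cut_of D e"
  proof (rule ccontr)
    assume "\<not> cut_of D u \<le> cut_of D e"
    then have "joined D u (cut_of D e)" by (simp add: joined_iff)
    then obtain a b where ab: "strip a b (cut_of D e) \<in> D" "a \<le> u" "u < b" "dyck_interval a b"
      using joinedE by blast
    then have "height b \<le> height u" by (auto simp: dyck_interval_def)
    then have "\<not> b \<le> e" using assms(3)[of b] ab(3) by auto
    then have "joined D e (cut_of D e)" using joinedI[OF ab(1), of e] ab assms(1) by simp
    then show False by (simp add: joined_iff)
  qed
  assume eq: "height (Suc e) = height u"
  \<comment> \<open>A tile joining e starts no higher than the end point of e, hence at u or before.\<close>
  have "cut_of D e \<le> cut_of D u"
  proof (rule ccontr)
    assume "\<not> cut_of D e \<le> cut_of D u"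
    then have "joined D e (cut_of D u)" by (simp add: joined_iff)
    then obtain a b where ab: "strip a b (cut_of D u) \<in> D" "a \<le> e" "e < b" "dyck_interval a b"
      using joinedE by blast
    then have "height a \<le> height u" by (auto simp: dyck_interval_def eq[symmetric])
    then have "\<not> u < a" using assms(3)[of a] ab(2) by auto
    then have "joined D u (cut_of D u)" using joinedI[OF ab(1), of u] ab assms(1) by simp
    then show False by (simp add: joined_iff)
  qed
  then show "cut_of D e = cut_of D u" using le by simp
qed

lemma tile_code_cut_of: "tile_code h (cut_of D)"
  unfolding tile_code_def
  by (intro conjI allI impI)
     (simp_all add: prof cut_of_le cut_of_reflect cut_of_matched)

text \<open>
  A tile is a maximal run because tiles are disjoint; conversely a run is the tile through its first
  cell.
\<close>
lemma blocks_cut_of: "blocks h (cut_of D) = D"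
proof (intro equalityI subsetI)
  fix \<eta> assume \<eta>: "\<eta> \<in> D"
  obtain a b l where strip: "\<eta> = strip a b l" and dyck: "dyck_interval a b"
    using flat_tiling_strip[OF flat \<eta>] by blast
  have ab: "a \<le> b" "b \<le> 2 * N" using dyck by (auto simp: dyck_interval_def)
  have ends: "l < h m" if "a \<le> m" "m \<le> b" for m
    using flat_cell_iff[of m l] \<eta> in_strip_iff[of m l a b l] that unfolding strip by blast
  have h0: "h 0 = 0" "h (2 * N) = 0"
    using code_layers_0[OF tile_code_cut_of] code_layers_top[OF tile_code_cut_of] by simp_all
  have pos: "0 < a" "b < 2 * N"
    using ends[of a] ends[of b] ab h0 by (auto simp: le_less intro: gr0I)
  have not_joined: "\<not> joined D e l" if "(e < a \<and> a \<le> Suc e) \<or> (e = b)" for e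
  proof
    assume "joined D e l"
    then obtain a' b' where ab': "strip a' b' l \<in> D" "a' \<le> e" "e < b'" using joinedE by blast
    let ?m = "if e = b then b else a"
    have "cell_at ?m (int l) \<in> strip a' b' l \<inter> \<eta>"
      using that ab' ab unfolding strip by (auto simp: in_strip_iff)
    then have "strip a' b' l = \<eta>" using flat_tiling_disjoint[OF flat ab'(1) \<eta>] by blast
    then have "a' = a \<and> b' = b" using strip_eq_iff[of a b l a' b' l] ab unfolding strip by simp
    then show False using that ab' by auto
  qed
  have "run h (cut_of D) a b l"
    unfolding run_def
  proof (intro conjI allI impI)
    show "l < cut_of D e" if "a \<le> e" "e < b" for e
      using joinedI[of a b l e] \<eta> that unfolding strip joined_iff by simp
    show "cut_of D (a - 1) \<le> l"
      using not_joined[of "a - 1"] pos by (simp add: joined_iff not_less)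
    show "cut_of D b \<le> l" using not_joined[of b] by (simp add: joined_iff not_less)
  qed (use pos ab ends in auto)
  then show "\<eta> \<in> blocks h (cut_of D)" unfolding strip blocks_def by blast
next
  fix \<eta> assume "\<eta> \<in> blocks h (cut_of D)"
  then obtain a b l where strip: "\<eta> = strip a b l" and run: "run h (cut_of D) a b l"
    by (auto simp: blocks_def)
  note r = runD[OF tile_code_cut_of run]
  have "cell_at a (int l) \<in> \<Union>D" using flat_cell_iff[of a l] r by simp
  then obtain \<eta>' where \<eta>': "\<eta>' \<in> D" "cell_at a (int l) \<in> \<eta>'" by blast
  obtain a' b' where ab': "\<eta>' = strip a' b' l" "a' \<le> a" "a \<le> b'"
    using flat_strip[OF \<eta>'] by blast
  have D: "strip a' b' l \<in> D" using \<eta>'(1) ab'(1) by simp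
  have "a' = a"
  proof (rule ccontr)
    assume "a' \<noteq> a"
    then have "joined D (a - 1) l" using ab' r(1) by (intro joinedI[OF D]) auto
    then show False using r(6) by (simp add: joined_iff)
  qed
  moreover have "b' \<le> b"
  proof (rule ccontr)
    assume "\<not> b' \<le> b"
    then have "joined D b l" using ab' r(2) by (intro joinedI[OF D]) auto
    then show False using r(7) by (simp add: joined_iff)
  qed
  moreover have "b \<le> b'"
  proof (rule ccontr)
    assume "\<not> b \<le> b'"
    then have "joined D b' l" using r(5)[of b'] ab' by (simp add: joined_iff)
    then obtain a'' b'' where ab'': "strip a'' b'' l \<in> D" "a'' \<le> b'" "b' < b''" using joinedE by blast
    have "cell_at b' (int l) \<in> strip a'' b'' l \<inter> strip a' b' l"
      using ab'' ab' by (simp add: in_strip_iff)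
    then have "strip a'' b'' l = strip a' b' l"
      using flat_tiling_disjoint[OF flat ab''(1) D] by blast
    then show False using strip_eq_iff[of a' b' l a'' b'' l] ab' ab'' by simp
  qed
  ultimately show "\<eta> \<in> D" using D unfolding strip by simp
qed

lemma layers_of_flat: "m \<le> 2 * N \<Longrightarrow> layers_of D m = h m"
  unfolding layers_of_def flat_cell_iff by simp

end

text \<open>
  Layers and cuts can be read off from a tiling, which inverts the construction of a tiling
  from a code.
\<close>
lemma tiling_of_bij: "bij_betw tiling_of half_codes (Dsym N lam)"
proof (rule bij_betw_byWitness[where f' = "\<lambda>D. encode (layers_of D) (cut_of D)"])
  show "\<forall>xs\<in>half_codes. encode (layers_of (tiling_of xs)) (cut_of (tiling_of xs)) = xs"
  proof
    fix xs assume xs: "xs \<in> half_codes"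
    note code = tile_code_full[OF xs]
    have "encode (layers_of (tiling_of xs)) (cut_of (tiling_of xs)) = encode (full_layers xs) (full_cut xs)"
      unfolding tiling_of_def by (intro encode_cong of_blocks[OF code])
    also have "\<dots> = xs"
    proof (rule nth_equalityI)
      have len: "length xs = N" using xs by (simp add: half_codes_iff)
      then show "length (encode (full_layers xs) (full_cut xs)) = length xs"
        by (simp add: encode_def)
      fix e assume "e < length (encode (full_layers xs) (full_cut xs))"
      then have "e < N" by (simp add: encode_def)
      then show "encode (full_layers xs) (full_cut xs) ! e = xs ! e"
        using len by (simp add: encode_def full_left code_layers_def code_cut_def)
    qed
    finally show "encode (layers_of (tiling_of xs)) (cut_of (tiling_of xs)) = xs" .
  qed
  show "tiling_of ` half_codes \<subseteq> Dsym N lam"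
  proof (intro image_subsetI)
    fix xs assume xs: "xs \<in> half_codes"
    note code = tile_code_full[OF xs]
    show "tiling_of xs \<in> Dsym N lam"
      unfolding tiling_of_def
      by (rule Dsym_of_flat_tiling[OF code_profile[OF code] flat_tiling_blocks[OF code]])
  qed
  have *: "encode (layers_of D) (cut_of D) \<in> half_codes \<and>
      tiling_of (encode (layers_of D) (cut_of D)) = D" if D: "D \<in> Dsym N lam" for D
  proof -
    obtain h where h: "profile h" "flat_tiling h D" using flat_tiling_of_Dsym[OF D] .
    note code = tile_code_cut_of[OF h]
    have e: "encode (layers_of D) (cut_of D) = encode h (cut_of D)"
      by (intro encode_cong layers_of_flat[OF h] refl)
    have "tiling_of (encode h (cut_of D)) = blocks h (cut_of D)"
      unfolding tiling_of_def
      by (intro blocks_cong full_layers_encode[OF code] full_cut_encode[OF code])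
    then show ?thesis using e encode_code[OF code] blocks_cut_of[OF h] by simp
  qed
  show "\<forall>D\<in>Dsym N lam. tiling_of (encode (layers_of D) (cut_of D)) = D" using * by blast
  show "(\<lambda>D. encode (layers_of D) (cut_of D)) ` Dsym N lam \<subseteq> half_codes" using * by blast
qed

end

section \<open>Tile statistics in terms of codes\<close>

lemma code_layers_length: "code_layers i xs (length xs) = code_end i xs"
  by (induction i xs rule: code_end.induct) simp_all

text \<open>
  If all up steps on the path and on the stack are matched, every cut is subtracted once at an up
  step and once at a down step on the left, and twice at the up step on the right. The cuts on the stack,
  whose up steps precede \<open>w\<close>, are added back.
\<close>
lemma code_weight_balance:
  assumes "admissible w st i xs" "length st + count_list w Up = count_list w Down"
  shows "(\<Sum>(c, h)\<leftarrow>xs. 2 * int h - int c) + 2 * int i + int (sum_list st)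
       = 2 * int (code_weight w i xs) + 2 * int (code_end i xs)"
  using assms
proof (induction w st i xs rule: admissible.induct)
  case (2 w st i c h xs)
  then have "c \<le> i" by auto
  then show ?case using 2 by simp
qed auto

context symmetric_dyck_path
begin

lemma side_of_center:
  "left_of_center N (cell_at m l) \<longleftrightarrow> m < N" "on_center N (cell_at m l) \<longleftrightarrow> m = N"
  by (auto simp: left_of_center_def on_center_def cell_at_def)

lemma card_strip: "a \<le> b \<Longrightarrow> card (strip a b l) = Suc b - a"
  unfolding strip_def by (subst card_image) (auto simp: inj_on_def)

context
  fixes h c :: "nat \<Rightarrow> nat"
  assumes code: "tile_code h c"
begin

text \<open>
  The tiles that meet the left half are indexed by the position \<open>(a, l)\<close> of their leftmost cell. A cell is
  leftmost in its tile if it is not joined to the cell before it, which for index \<open>a\<close> happens in the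
  layers from \<open>c (a - 1)\<close> on.
\<close>
definition run_end :: "nat \<Rightarrow> nat \<Rightarrow> nat" where
  "run_end a l = (SOME b. run h c a b l)"

definition run_starts :: "(nat \<times> nat) set" where
  "run_starts = (SIGMA a:{1..N}. {c (a - 1)..<h a})"

lemma run_end:
  assumes "(a, l) \<in> run_starts"
  shows "run h c a (run_end a l) l"
proof -
  have a: "0 < a" "a \<le> N" "c (a - 1) \<le> l" "l < h a" using assms by (auto simp: run_starts_def)
  obtain a' b where r: "run h c a' b l" "a' \<le> a" "a \<le> b"
  proof (rule run_exists[OF code])
    show "a \<le> 2 * N" using a(2) by simp
  qed (rule a(4))
  have "a' = a"
  proof (rule ccontr)
    assume "a' \<noteq> a"
    then have "a' \<le> a - 1" "a - 1 < b" using r(2,3) a(1) by linarith+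
    then have "l < c (a - 1)" by (rule runD(5)[OF code r(1)])
    then show False using a(3) by simp
  qed
  then have "run h c a b l" using r(1) by simp
  then show ?thesis unfolding run_end_def by (rule someI)
qed

lemma half_tiles:
  "positive_tiles N (blocks h c) \<union> zero_tiles N (blocks h c) =
     (\<lambda>(a, l). strip a (run_end a l) l) ` run_starts" (is "?L = ?R")
proof (intro equalityI subsetI)
  fix \<eta> assume "\<eta> \<in> ?L"
  then have "\<eta> \<in> blocks h c" and near: "(\<forall>x\<in>\<eta>. left_of_center N x) \<or> (\<exists>x\<in>\<eta>. on_center N x)"
    by (auto simp: positive_tiles_def zero_tiles_def)
  then obtain a b l where \<eta>: "\<eta> = strip a b l" and run: "run h c a b l" by (auto simp: blocks_def)
  note r = runD[OF code run]
  have "a \<le> N"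
    using near
  proof
    assume "\<forall>x\<in>\<eta>. left_of_center N x"
    moreover have "cell_at a (int l) \<in> \<eta>" using r(2) by (simp add: \<eta> in_strip_iff)
    ultimately show ?thesis using side_of_center(1)[of a "int l"] by auto
  next
    assume "\<exists>x\<in>\<eta>. on_center N x"
    then show ?thesis by (auto simp: \<eta> strip_def side_of_center)
  qed
  then have s: "(a, l) \<in> run_starts" using r by (auto simp: run_starts_def)
  have "run_end a l = b"
    using run_unique[OF code run run_end[OF s], of a] runD(2)[OF code run_end[OF s]] r(2) by simp
  then show "\<eta> \<in> ?R" using s \<eta> by (intro image_eqI[of _ _ "(a, l)"]) simp_all
next
  fix \<eta> assume "\<eta> \<in> ?R"
  then obtain a l where s: "(a, l) \<in> run_starts" and \<eta>: "\<eta> = strip a (run_end a l) l" by auto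
  let ?b = "run_end a l"
  note run = run_end[OF s]
  have in_blocks: "\<eta> \<in> blocks h c" using run unfolding \<eta> blocks_def by blast
  have "a \<le> N" using s by (simp add: run_starts_def)
  show "\<eta> \<in> ?L"
  proof (cases "?b < N")
    case True
    then have "\<forall>x\<in>\<eta>. left_of_center N x" by (auto simp: \<eta> strip_def side_of_center)
    then show ?thesis using in_blocks by (simp add: positive_tiles_def)
  next
    case False
    then have "cell_at N (int l) \<in> \<eta>" using \<open>a \<le> N\<close> by (simp add: \<eta> in_strip_iff)
    then have "\<exists>x\<in>\<eta>. on_center N x" using side_of_center(2)[of N "int l"] by auto
    then show ?thesis using in_blocks by (simp add: zero_tiles_def)
  qed
qed

lemma inj_half_tiles: "inj_on (\<lambda>(a, l). strip a (run_end a l) l) run_starts"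
proof (rule inj_onI, clarify)
  fix a l a' l' assume s: "(a, l) \<in> run_starts" and "strip a (run_end a l) l = strip a' (run_end a' l') l'"
  then show "a = a' \<and> l = l'"
    using strip_eq_iff[of a "run_end a l" l a' "run_end a' l'" l'] runD(2)[OF code run_end[OF s]]
    by simp
qed

lemma finite_run_starts: "finite run_starts"
  by (simp add: run_starts_def)

lemma finite_half_tiles:
  "finite (positive_tiles N (blocks h c))" "finite (zero_tiles N (blocks h c))"
  using finite_imageI[OF finite_run_starts, of "\<lambda>(a, l). strip a (run_end a l) l"]
  unfolding half_tiles[symmetric] by simp_all

lemma half_tiles_disjoint: "positive_tiles N (blocks h c) \<inter> zero_tiles N (blocks h c) = {}"
  by (auto simp: positive_tiles_def zero_tiles_def left_of_center_def on_center_def)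

lemma tiles_half: "tiles_plus N (blocks h c) + tiles_zero N (blocks h c) = (\<Sum>a = 1..N. h a - c (a - 1))"
proof -
  have "tiles_plus N (blocks h c) + tiles_zero N (blocks h c) =
      card (positive_tiles N (blocks h c) \<union> zero_tiles N (blocks h c))"
    unfolding tiles_plus_def tiles_zero_def
    by (rule card_Un_disjoint[symmetric]) (rule finite_half_tiles half_tiles_disjoint)+
  also have "\<dots> = card run_starts"
    unfolding half_tiles by (rule card_image[OF inj_half_tiles])
  also have "\<dots> = (\<Sum>a = 1..N. h a - c (a - 1))"
    by (simp add: run_starts_def card_SigmaI)
  finally show ?thesis .
qed

lemma area_half: "area_plus N (blocks h c) + area_zero N (blocks h c) = (\<Sum>a = 1..N. h a)"
proof -
  let ?P = "positive_tiles N (blocks h c)" and ?Z = "zero_tiles N (blocks h c)"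
  define half where "half \<eta> = {x \<in> \<eta>. left_of_center N x \<or> on_center N x}" for \<eta> :: "cell set"
  have blocks: "?P \<union> ?Z \<subseteq> blocks h c" by (auto simp: positive_tiles_def zero_tiles_def)
  have "area_plus N (blocks h c) = (\<Sum>\<eta>\<in>?P. card (half \<eta>))"
    unfolding area_plus_def
  proof (intro sum.cong refl)
    fix \<eta> assume "\<eta> \<in> ?P"
    then have "half \<eta> = \<eta>" by (auto simp: half_def positive_tiles_def)
    then show "card \<eta> = card (half \<eta>)" by simp
  qed
  then have "area_plus N (blocks h c) + area_zero N (blocks h c) = (\<Sum>\<eta>\<in>?P \<union> ?Z. card (half \<eta>))"
    unfolding area_zero_def half_def[symmetric]
    by (simp add: sum.union_disjoint finite_half_tiles half_tiles_disjoint)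
  also have "\<dots> = card (\<Union>\<eta>\<in>?P \<union> ?Z. half \<eta>)"
  proof (rule card_UN_disjoint[symmetric])
    show "finite (?P \<union> ?Z)" using finite_half_tiles by simp
    show "\<forall>\<eta>\<in>?P \<union> ?Z. finite (half \<eta>)"
    proof
      fix \<eta> assume "\<eta> \<in> ?P \<union> ?Z"
      then obtain a b l where "\<eta> = strip a b l" using blocks by (auto simp: blocks_def)
      then show "finite (half \<eta>)" by (simp add: half_def strip_def)
    qed
    show "\<forall>\<eta>\<in>?P \<union> ?Z. \<forall>\<eta>'\<in>?P \<union> ?Z. \<eta> \<noteq> \<eta>' \<longrightarrow> half \<eta> \<inter> half \<eta>' = {}"
    proof (intro ballI impI)
      fix \<eta> \<eta>' assume "\<eta> \<in> ?P \<union> ?Z" "\<eta>' \<in> ?P \<union> ?Z" "\<eta> \<noteq> \<eta>'"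
      then have "\<eta> \<inter> \<eta>' = {}"
        using flat_tiling_disjoint[OF flat_tiling_blocks[OF code]] blocks by blast
      then show "half \<eta> \<inter> half \<eta>' = {}" by (auto simp: half_def)
    qed
  qed
  also have "(\<Union>\<eta>\<in>?P \<union> ?Z. half \<eta>) = (\<lambda>(m, l). cell_at m (int l)) ` (SIGMA m:{1..N}. {..<h m})"
  proof (intro equalityI subsetI)
    fix x assume "x \<in> (\<Union>\<eta>\<in>?P \<union> ?Z. half \<eta>)"
    then obtain \<eta> where \<eta>: "\<eta> \<in> blocks h c" "x \<in> \<eta>" "left_of_center N x \<or> on_center N x"
      using blocks by (auto simp: half_def)
    then obtain m l where x: "x = cell_at m (int l)" by (auto simp: blocks_def strip_def)
    have "l < h m" using cell_in_blocks[OF code, of m l] \<eta> x by blast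
    moreover have "m \<le> N" using \<eta>(3) by (auto simp: x side_of_center)
    moreover have "m \<noteq> 0" using \<open>l < h m\<close> code_layers_0[OF code] by (cases m) auto
    ultimately show "x \<in> (\<lambda>(m, l). cell_at m (int l)) ` (SIGMA m:{1..N}. {..<h m})"
      unfolding x by (intro image_eqI[of _ _ "(m, l)"]) auto
  next
    fix x assume "x \<in> (\<lambda>(m, l). cell_at m (int l)) ` (SIGMA m:{1..N}. {..<h m})"
    then obtain m l where x: "x = cell_at m (int l)" "m \<le> N" "l < h m" by auto
    then obtain a b where r: "run h c a b l" "a \<le> m" "m \<le> b"
      using run_exists[OF code, of m l] by auto
    have "(\<forall>x\<in>strip a b l. left_of_center N x) \<or> (\<exists>x\<in>strip a b l. on_center N x)"
    proof (cases "b < N")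
      case False
      then have "cell_at N (int l) \<in> strip a b l" using r x by (simp add: in_strip_iff)
      then show ?thesis using side_of_center(2)[of N "int l"] by auto
    qed (auto simp: strip_def side_of_center)
    moreover have "strip a b l \<in> blocks h c" using r(1) unfolding blocks_def by blast
    ultimately have "strip a b l \<in> ?P \<union> ?Z" by (simp add: positive_tiles_def zero_tiles_def)
    moreover have "x \<in> half (strip a b l)"
      using r x by (auto simp: half_def in_strip_iff side_of_center)
    ultimately show "x \<in> (\<Union>\<eta>\<in>?P \<union> ?Z. half \<eta>)" by blast
  qed
  also have "card \<dots> = card (SIGMA m:{1..N}. {..<h m})"
    by (rule card_image) (auto simp: inj_on_def)
  also have "\<dots> = (\<Sum>a = 1..N. h a)"
    by (simp add: card_SigmaI)
  finally show ?thesis .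
qed

text \<open>
  Exactness of the division for the positive tiles alone makes the two halved sums add up to half the total.
\<close>
lemma even_positive: "even (area_plus N (blocks h c) + tiles_plus N (blocks h c))"
proof -
  have "even (card \<eta> + 1)" if \<eta>: "\<eta> \<in> positive_tiles N (blocks h c)" for \<eta>
  proof -
    obtain a b l where "\<eta> = strip a b l" "run h c a b l"
      using \<eta> by (auto simp: positive_tiles_def blocks_def)
    then have card: "card \<eta> + 1 = b - a + 2" and dyck: "dyck_interval a b"
      using card_strip[of a b l] runD(2)[OF code, of a b l] run_dyck_interval[OF code, of a b l]
      by (simp_all add: Suc_diff_le)
    have "int b - int a = 2 * (ups lam b - ups lam a)"
      using dyck by (simp add: dyck_interval_def height_def)
    moreover have "a \<le> b" using dyck by (simp add: dyck_interval_def)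
    ultimately have "even (int (b - a))" by (simp add: of_nat_diff)
    then show ?thesis unfolding card by simp
  qed
  then have "even (\<Sum>\<eta>\<in>positive_tiles N (blocks h c). card \<eta> + 1)" by (intro dvd_sum)
  also have "(\<Sum>\<eta>\<in>positive_tiles N (blocks h c). card \<eta> + 1)
      = area_plus N (blocks h c) + tiles_plus N (blocks h c)"
    unfolding area_plus_def tiles_plus_def sum.distrib by simp
  finally show ?thesis .
qed

lemma tiles_zero_blocks: "tiles_zero N (blocks h c) = h N"
proof -
  define tile where "tile l = (THE \<eta>. \<eta> \<in> blocks h c \<and> cell_at N (int l) \<in> \<eta>)" for l
  have tile: "tile l \<in> blocks h c \<and> cell_at N (int l) \<in> tile l" if "l < h N" for l
    unfolding tile_def
  proof (rule theI')
    have "cell_at N (int l) \<in> \<Union>(blocks h c)" using cell_in_blocks[OF code, of N l] that by simp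
    then obtain \<eta> where \<eta>: "\<eta> \<in> blocks h c" "cell_at N (int l) \<in> \<eta>" by blast
    show "\<exists>!\<eta>. \<eta> \<in> blocks h c \<and> cell_at N (int l) \<in> \<eta>"
    proof (rule ex1I)
      fix \<eta>' assume "\<eta>' \<in> blocks h c \<and> cell_at N (int l) \<in> \<eta>'"
      then show "\<eta>' = \<eta>"
        using \<eta> flat_tiling_disjoint[OF flat_tiling_blocks[OF code], of \<eta>' \<eta>] by blast
    qed (use \<eta> in simp)
  qed
  have level: "l = l'" if "\<eta> \<in> blocks h c" "cell_at m (int l) \<in> \<eta>" "cell_at m' (int l') \<in> \<eta>"
    for \<eta> m m' l l'
    using that by (auto simp: blocks_def in_strip_iff)
  have "zero_tiles N (blocks h c) = tile ` {..<h N}"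
  proof (intro equalityI subsetI)
    fix \<eta> assume \<eta>: "\<eta> \<in> zero_tiles N (blocks h c)"
    then obtain x where x: "\<eta> \<in> blocks h c" "x \<in> \<eta>" "on_center N x" by (auto simp: zero_tiles_def)
    then obtain m l where "x = cell_at m (int l)" by (auto simp: blocks_def strip_def)
    then have center: "cell_at N (int l) \<in> \<eta>" using x by (simp add: side_of_center)
    then have l: "l < h N" using cell_in_blocks[OF code, of N l] x(1) by blast
    then have "\<eta> = tile l"
      using tile[OF l] center x(1) flat_tiling_disjoint[OF flat_tiling_blocks[OF code]] by blast
    then show "\<eta> \<in> tile ` {..<h N}" using l by simp
  next
    fix \<eta> assume "\<eta> \<in> tile ` {..<h N}"
    then obtain l where l: "l < h N" "\<eta> = tile l" by auto
    moreover have "on_center N (cell_at N (int l))" by (simp add: side_of_center)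
    ultimately show "\<eta> \<in> zero_tiles N (blocks h c)"
      using tile[of l] unfolding zero_tiles_def by blast
  qed
  moreover have "inj_on tile {..<h N}"
  proof (rule inj_onI)
    fix l l' assume "l \<in> {..<h N}" "l' \<in> {..<h N}" "tile l = tile l'"
    then show "l = l'" using level[of "tile l" N l N l'] tile[of l] tile[of l'] by simp
  qed
  ultimately show ?thesis by (simp add: tiles_zero_def card_image)
qed

lemma art_half:
  "art_plus N (blocks h c) + art_zero N (blocks h c) = (\<Sum>e<N. 2 * h (Suc e) - c e) div 2"
proof -
  have "art_plus N (blocks h c) + art_zero N (blocks h c)
      = ((area_plus N (blocks h c) + area_zero N (blocks h c)) +
         (tiles_plus N (blocks h c) + tiles_zero N (blocks h c))) div 2"
  proof -
    have "art_plus N (blocks h c) + art_zero N (blocks h c)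
        = ((area_plus N (blocks h c) + tiles_plus N (blocks h c)) +
           (area_zero N (blocks h c) + tiles_zero N (blocks h c))) div 2"
      unfolding art_plus_def art_zero_def
      by (rule div_plus_div_distrib_dvd_left[OF even_positive, symmetric])
    then show ?thesis by (simp only: ac_simps)
  qed
  also have "\<dots> = (\<Sum>a = 1..N. h a + (h a - c (a - 1))) div 2"
    by (simp only: area_half tiles_half sum.distrib)
  also have "(\<Sum>a = 1..N. h a + (h a - c (a - 1))) = (\<Sum>e<N. 2 * h (Suc e) - c e)"
  proof (rule sum.reindex_bij_witness[of _ Suc "\<lambda>a. a - 1"])
    fix a assume a: "a \<in> {1..N}"
    then have "a - 1 < 2 * N" "Suc (a - 1) = a" by auto
    then have "c (a - 1) \<le> h a" using code_cut_le(2)[OF code, of "a - 1"] by simp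
    then show "2 * h (Suc (a - 1)) - c (a - 1) = h a + (h a - c (a - 1))"
      using \<open>Suc (a - 1) = a\<close> by simp
  qed auto
  finally show ?thesis .
qed

end

text \<open>
  The balance of up and down steps on the left half expresses that no vertex lies on the center line.
\<close>
lemma tiling_of_stats:
  assumes "xs \<in> half_codes"
  shows "tiles_zero N (tiling_of xs) = code_end 0 xs"
    and "2 * count_list (take N lam) Up = N \<Longrightarrow>
      art_plus N (tiling_of xs) + art_zero N (tiling_of xs) = code_weight (take N lam) 0 xs + code_end 0 xs"
proof -
  note code = tile_code_full[OF assms]
  have len: "length xs = N" using assms by (simp add: half_codes_iff)
  show "tiles_zero N (tiling_of xs) = code_end 0 xs"
    unfolding tiling_of_def tiles_zero_blocks[OF code]
    using code_layers_length[of 0 xs] len by (simp add: full_left)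
  assume balanced: "2 * count_list (take N lam) Up = N"
  let ?f = "\<lambda>e. 2 * full_layers xs (Suc e) - full_cut xs e"
  have "int (\<Sum>e<N. ?f e) = (\<Sum>e<N. 2 * int (snd (xs ! e)) - int (fst (xs ! e)))"
    unfolding of_nat_sum
  proof (intro sum.cong refl)
    fix e assume e: "e \<in> {..<N}"
    then have "full_cut xs e \<le> full_layers xs (Suc e)" using code_cut_le(2)[OF code, of e] by simp
    moreover have "full_cut xs e = fst (xs ! e)" "full_layers xs (Suc e) = snd (xs ! e)"
      using e len by (simp_all add: full_left code_cut_def code_layers_def)
    ultimately show "int (?f e) = 2 * int (snd (xs ! e)) - int (fst (xs ! e))"
      by (simp add: of_nat_diff)
  qed
  also have "\<dots> = (\<Sum>(c, h)\<leftarrow>xs. 2 * int h - int c)"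
    by (simp add: sum_list_sum_nth len split_beta atLeast0LessThan)
  also have "\<dots> = 2 * int (code_weight (take N lam) 0 xs) + 2 * int (code_end 0 xs)"
  proof -
    have "length ([] :: nat list) + count_list (take N lam) Up = count_list (take N lam) Down"
      using count_Up_Down[of "take N lam"] balanced length_lam by simp
    then show ?thesis
      using code_weight_balance[of "take N lam" "[]" 0 xs] assms by (simp add: half_codes_def)
  qed
  also have "\<dots> = int (2 * (code_weight (take N lam) 0 xs + code_end 0 xs))" by simp
  finally have "(\<Sum>e<N. ?f e) = 2 * (code_weight (take N lam) 0 xs + code_end 0 xs)"
    by (simp only: of_nat_eq_iff)
  then show "art_plus N (tiling_of xs) + art_zero N (tiling_of xs)
      = code_weight (take N lam) 0 xs + code_end 0 xs"
    unfolding tiling_of_def art_half[OF code] by simp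
qed

lemma card_Dsym: "real (card (Dsym N lam)) = code_gf 1 (\<lambda>_. 1) (take N lam) [] 0"
  using bij_betw_same_card[OF tiling_of_bij]
    sum_admissible[where q = "1 :: real" and f = "\<lambda>_. 1" and w = "take N lam" and st = "[]" and i = 0]
  by (simp add: half_codes_def)

lemma sum_Dsym:
  assumes "2 * count_list (take N lam) Up = N"
  shows "(\<Sum>D\<in>Dsym N lam. q ^ (art_plus N D + art_zero N D) * t ^ tiles_zero N D)
       = code_gf q (\<lambda>j. (t * q) ^ j) (take N lam) [] 0"
proof -
  have "(\<Sum>D\<in>Dsym N lam. q ^ (art_plus N D + art_zero N D) * t ^ tiles_zero N D)
      = (\<Sum>xs\<in>half_codes. q ^ (art_plus N (tiling_of xs) + art_zero N (tiling_of xs)) *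
           t ^ tiles_zero N (tiling_of xs))"
    by (rule sum.reindex_bij_betw[OF tiling_of_bij, symmetric])
  also have "\<dots> = (\<Sum>xs\<in>half_codes. q ^ code_weight (take N lam) 0 xs * (t * q) ^ code_end 0 xs)"
    by (intro sum.cong refl)
       (simp add: tiling_of_stats(2)[OF _ assms] tiling_of_stats(1) power_add power_mult_distrib mult_ac)
  also have "\<dots> = code_gf q (\<lambda>j. (t * q) ^ j) (take N lam) [] 0"
    unfolding half_codes_def by (rule sum_admissible)
  finally show ?thesis .
qed

end

lemma symmetric_forest_dyck_path:
  assumes "symmetric_forest F"
  shows "symmetric_dyck_path (forest_size F) (forest_path F)"
  using forest_path_height[of _ F] symmetric_forest_path_ups[OF assms]
  by unfold_locales simp_all

lemma hooks_pos: "h \<in> set (hooks F) \<Longrightarrow> 0 < h"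
  by (induction F rule: forest_induct) auto

lemma center_vertices_le: "center_vertices F \<le> forest_size (left_part F)"
proof (induction F rule: left_part.induct)
  case (1 F)
  then show ?case
    by (cases "odd (length F)") (simp_all add: center_vertices.simps[of F] left_part.simps[of F])
qed

theorem corollary6p2:
  fixes F :: pforest and n k N :: nat and lam :: "step list" and q t :: "'a::field"
  assumes "symmetric_forest F"
    and "forest_size (left_part F) = n"
    and "center_vertices F = k"
    and "forest_size F = N"
    and "forest_path F = lam"
  shows "real (card (Dsym N lam)) =
           2 ^ (n - k) * (fact n / (\<Prod>h\<leftarrow>hooks (left_part F). real h)) \<and>
         (k = 0 \<and> (\<forall>h \<in> set (hooks (left_part F)). qint q h \<noteq> 0) \<longrightarrow>
         (\<Sum>D \<in> Dsym N lam. q ^ (art_plus N D + art_zero N D) * t ^ tiles_zero N D) =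
           (\<Prod>i = 1..n. 1 + t * q ^ i) *
           (qfact q n / (\<Prod>h\<leftarrow>hooks (left_part F). qint q h)))"
proof (intro conjI impI)
  interpret symmetric_dyck_path N lam
    using symmetric_forest_dyck_path[OF assms(1)] assms(4,5) by simp
  have half: "half_path F = take N lam" using assms(4,5) by (simp add: half_path_def)
  show "real (card (Dsym N lam)) = 2 ^ (n - k) * (fact n / (\<Prod>h\<leftarrow>hooks (left_part F). real h))"
  proof -
    let ?P = "\<Prod>h\<leftarrow>hooks (left_part F). real h"
    have "?P \<noteq> 0" using hooks_pos[of 0 "left_part F"] by (auto simp: prod_list_zero_iff)
    moreover have "?P * 2 ^ k * real (card (Dsym N lam)) = 2 ^ n * fact n"
      using code_gf_half_path_count[OF assms(1)] assms(2,3) half by (simp add: card_Dsym)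
    moreover have "(2 :: real) ^ n = 2 ^ (n - k) * 2 ^ k"
      using center_vertices_le[of F] assms(2,3) by (simp flip: power_add)
    ultimately show ?thesis by (simp add: field_simps)
  qed
  assume "k = 0 \<and> (\<forall>h\<in>set (hooks (left_part F)). qint q h \<noteq> 0)"
  then have k: "center_vertices F = 0" and "\<forall>h\<in>set (hooks (left_part F)). qint q h \<noteq> 0"
    using assms(3) by simp_all
  then have nz: "(\<Prod>h\<leftarrow>hooks (left_part F). qint q h) \<noteq> 0" by (auto simp: prod_list_zero_iff)
  have even: "even (length F)"
    using k center_vertices.simps[of F] by (auto split: if_splits)
  have "2 * count_list (take N lam) Up = length (take N lam)"
    using half_path_even[OF assms(1) even] forest_path_ups[of "left_part F"] half
    by (simp add: ups_def)
  then have "2 * count_list (take N lam) Up = N" by (simp add: length_lam)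
  from sum_Dsym[OF this, of q t]
  show "(\<Sum>D\<in>Dsym N lam. q ^ (art_plus N D + art_zero N D) * t ^ tiles_zero N D) =
      (\<Prod>i = 1..n. 1 + t * q ^ i) * (qfact q n / (\<Prod>h\<leftarrow>hooks (left_part F). qint q h))"
    using code_gf_half_path_weighted[OF assms(1) k, of q t] nz half assms(2)
    by (simp add: field_simps)
qed

end
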